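(* Let $r=1/2$ and consider the test statistics $T(\boldsymbol{y})=\sum_{j=1}^\infty\kappa_j^2y_j^2$ in the Gaussian sequence setting described in the context, under D1 and D2. For $l=1,2,\ldots$ and $P_0>0$ put $$U(l,P_0)=\Bigl\{f:\ f=\sum_{j=1}^{l}\theta_j\phi_j,\ \|f\|\le P_0\Bigr\},\qquad \Xi=\{f:\ f\in U(l,P_0)\text{ for some integer }l\text{ and some }P_0>0\}.$$ Then: (i) for all $l$, $P_0$, any subsequence of alternatives $f_{n_i}\in\gamma U(l,P_0)$ ($\gamma>0$) with $cn_i^{-1/2}<\|f_{n_i}\|<Cn_i^{-1/2}$ (constants $0<c<C$), $n_i\to\infty$, is consistent; (ii) if $f\in L_2(0,1)$, $f\notin\Xi$, then in any convex ortho-symmetric set $V$ containing $f$ there is an inconsistent subsequence of alternatives $f_{n_i}\in V$ with $cn_i^{-1/2}<\|f_{n_i}\|<Cn_i^{-1/2}$ for some $0<c<C$, where $n_i\to\infty$.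
   Context: Setting. $(\phi_j)_{j\ge1}$ is an orthonormal basis of $L_2(0,1)$ and $f=\sum_j\theta_j\phi_j$ is identified with $\boldsymbol{\theta}=\{\theta_j\}$. One observes independent random variables $y_j=\theta_j+n^{-1/2}\sigma_j\xi_j$, $j\ge1$, where $\xi_j$ are Gaussian with $\mathbf{E}\xi_j=0$, $\mathbf{E}\xi_j^2=1$. The hypothesis is $\theta_j=0$ for all $j$. D1: the sequence $\kappa_j^2$ is decreasing and $\sum_{j=1}^\infty\kappa_j^2<\infty$. D2: there is $C>0$ such that $0<\sigma_j<C$ for all $j$. A test $K_n$ generated by $T$ rejects the hypothesis when $T(\boldsymbol{y})$ exceeds a threshold; $\alpha(K_n)$, $\beta(K_n,f)$ are type I and type II error probabilities. A sequence $f_n$ is consistent if for any $\alpha\in(0,1)$, for tests $K_n$ generated by $T$ with $\alpha(K_n)=\alpha(1+o(1))$, $\limsup_n\beta(K_n,f_n)<1-\alpha$; it is inconsistent if $\liminf_n(\alpha(K_n)+\beta(K_n,f_n))\ge1$ for each sequence of tests $K_n$ generated by $T$. For alternatives given only along $n_i\to\infty$ the limits are taken along $n_i$. A set $V$ is ortho-symmetric if $\sum_j\theta_j\phi_j\in V$ implies $\sum_j\tilde\theta_j\phi_j\in V$ for all $\tilde\theta_j\in\{\theta_j,-\theta_j\}$. *)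

theory Defs
  imports "HOL-Probability.Probability"
begin

text \<open>
  All sequences are indexed by \<^typ>\<open>nat\<close> from \<open>0\<close>, so index \<open>j\<close> here stands for \<open>j + 1\<close>
  in the usual numbering; a sum over the first \<open>l\<close> basis elements is a sum over \<open>j < l\<close>.
\<close>

section \<open>The space $L_2(0,1)$\<close>

text \<open>
  Elements are represented by functions on the real line of which only the restriction
  to \<open>(0,1)\<close> matters; two functions represent the same element when they agree almost
  everywhere on \<open>(0,1)\<close>.
\<close>

abbreviation unit_measure :: "real measure" where
  "unit_measure \<equiv> lebesgue_on {0<..<1}"

definition L2 :: "(real \<Rightarrow> real) set" where
  "L2 = {f \<in> borel_measurable unit_measure. integrable unit_measure (\<lambda>x. (f x)\<^sup>2)}"

definition L2_inner :: "(real \<Rightarrow> real) \<Rightarrow> (real \<Rightarrow> real) \<Rightarrow> real" where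
  "L2_inner f g = (\<integral>x. f x * g x \<partial>unit_measure)"

definition L2_norm :: "(real \<Rightarrow> real) \<Rightarrow> real" where
  "L2_norm f = sqrt (L2_inner f f)"

definition L2_expansion :: "(nat \<Rightarrow> real \<Rightarrow> real) \<Rightarrow> (nat \<Rightarrow> real) \<Rightarrow> (real \<Rightarrow> real) \<Rightarrow> bool" where
  "L2_expansion \<phi> \<theta> f \<longleftrightarrow>
     f \<in> L2 \<and> (\<lambda>N. L2_norm (\<lambda>x. f x - (\<Sum>j<N. \<theta> j * \<phi> j x))) \<longlonglongrightarrow> 0"

definition L2_orthonormal_basis :: "(nat \<Rightarrow> real \<Rightarrow> real) \<Rightarrow> bool" where
  "L2_orthonormal_basis \<phi> \<longleftrightarrow>
     (\<forall>j. \<phi> j \<in> L2) \<and>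
     (\<forall>i j. L2_inner (\<phi> i) (\<phi> j) = (if i = j then 1 else 0)) \<and>
     (\<forall>f\<in>L2. \<exists>\<theta>. L2_expansion \<phi> \<theta> f)"

text \<open>The sequence with which \<open>f\<close> is identified: the coefficients of its expansion in \<open>\<phi>\<close>.\<close>

definition coeffs_of :: "(nat \<Rightarrow> real \<Rightarrow> real) \<Rightarrow> (real \<Rightarrow> real) \<Rightarrow> nat \<Rightarrow> real" where
  "coeffs_of \<phi> f j = L2_inner f (\<phi> j)"

definition L2_convex :: "(real \<Rightarrow> real) set \<Rightarrow> bool" where
  "L2_convex V \<longleftrightarrow>
     (\<forall>g\<in>V. \<forall>h\<in>V. \<forall>t\<in>{0..1}. (\<lambda>x. (1 - t) * g x + t * h x) \<in> V)"

text \<open>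
  The function \<open>h\<close> ranges over all representatives of the element with coefficients \<open>\<theta>'\<close>.
  Taking \<open>\<theta>' = \<theta>\<close>, an ortho-symmetric \<open>V\<close> is thus closed under almost everywhere equality,
  that is, it is a set of elements of the space and not merely of functions.
\<close>

definition ortho_symmetric :: "(nat \<Rightarrow> real \<Rightarrow> real) \<Rightarrow> (real \<Rightarrow> real) set \<Rightarrow> bool" where
  "ortho_symmetric \<phi> V \<longleftrightarrow>
     (\<forall>\<theta> \<theta>' g h. L2_expansion \<phi> \<theta> g \<longrightarrow> g \<in> V \<longrightarrow>
        (\<forall>j. \<theta>' j \<in> {\<theta> j, - \<theta> j}) \<longrightarrow> L2_expansion \<phi> \<theta>' h \<longrightarrow> h \<in> V)"

definition U_set :: "(nat \<Rightarrow> real \<Rightarrow> real) \<Rightarrow> nat \<Rightarrow> real \<Rightarrow> (real \<Rightarrow> real) set" where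
  "U_set \<phi> l P0 =
     {f \<in> L2. (\<exists>\<theta>. AE x in unit_measure. f x = (\<Sum>j<l. \<theta> j * \<phi> j x)) \<and> L2_norm f \<le> P0}"

definition Xi_set :: "(nat \<Rightarrow> real \<Rightarrow> real) \<Rightarrow> (real \<Rightarrow> real) set" where
  "Xi_set \<phi> = {f. \<exists>l\<ge>1. \<exists>P0>0. f \<in> U_set \<phi> l P0}"

section \<open>The Gaussian sequence model\<close>

definition standard_gaussian_noise :: "'w measure \<Rightarrow> (nat \<Rightarrow> 'w \<Rightarrow> real) \<Rightarrow> bool" where
  "standard_gaussian_noise M \<xi> \<longleftrightarrow>
     prob_space M \<and>
     prob_space.indep_vars M (\<lambda>_. borel) \<xi> UNIV \<and>
     (\<forall>j. distributed M lborel (\<xi> j) std_normal_density)"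

definition observation ::
  "(nat \<Rightarrow> real) \<Rightarrow> (nat \<Rightarrow> 'w \<Rightarrow> real) \<Rightarrow> nat \<Rightarrow> (nat \<Rightarrow> real) \<Rightarrow> 'w \<Rightarrow> nat \<Rightarrow> real" where
  "observation \<sigma> \<xi> n \<theta> \<omega> j = \<theta> j + real n powr (-1/2) * \<sigma> j * \<xi> j \<omega>"

text \<open>
  \<open>\<kappa>\<close> enters only through its squares. Positivity of the squares is what a strictly
  decreasing summable sequence has automatically; it is spelled out so that ties
  between the squares can be allowed.
\<close>

definition D1 :: "(nat \<Rightarrow> real) \<Rightarrow> bool" where
  "D1 \<kappa> \<longleftrightarrow> (\<forall>j. (\<kappa> j)\<^sup>2 > 0) \<and> decseq (\<lambda>j. (\<kappa> j)\<^sup>2) \<and> summable (\<lambda>j. (\<kappa> j)\<^sup>2)"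

definition D2 :: "(nat \<Rightarrow> real) \<Rightarrow> bool" where
  "D2 \<sigma> \<longleftrightarrow> (\<exists>C>0. \<forall>j. 0 < \<sigma> j \<and> \<sigma> j < C)"

text \<open>
  Under D1 and D2 the series converges almost surely in the model, for every square summable
  \<open>\<theta>\<close>; the value of \<^const>\<open>suminf\<close> on divergent series therefore plays no role.
\<close>

definition T_stat :: "(nat \<Rightarrow> real) \<Rightarrow> (nat \<Rightarrow> real) \<Rightarrow> real" where
  "T_stat \<kappa> y = (\<Sum>j. (\<kappa> j)\<^sup>2 * (y j)\<^sup>2)"

section \<open>Tests, consistency and inconsistency\<close>

text \<open>A test is the predicate of those observations for which the hypothesis is rejected.\<close>

type_synonym test = "(nat \<Rightarrow> real) \<Rightarrow> bool"

definition generated_by :: "((nat \<Rightarrow> real) \<Rightarrow> real) \<Rightarrow> test \<Rightarrow> bool" where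
  "generated_by T K \<longleftrightarrow> (\<exists>t. \<forall>y. K y \<longleftrightarrow> T y > t)"

definition type_I_error ::
  "'w measure \<Rightarrow> (nat \<Rightarrow> 'w \<Rightarrow> real) \<Rightarrow> (nat \<Rightarrow> real) \<Rightarrow> nat \<Rightarrow> test \<Rightarrow> real" where
  "type_I_error M \<xi> \<sigma> n K =
     measure M {\<omega> \<in> space M. K (observation \<sigma> \<xi> n (\<lambda>_. 0) \<omega>)}"

definition type_II_error ::
  "'w measure \<Rightarrow> (nat \<Rightarrow> 'w \<Rightarrow> real) \<Rightarrow> (nat \<Rightarrow> real) \<Rightarrow> (nat \<Rightarrow> real \<Rightarrow> real) \<Rightarrow>
   nat \<Rightarrow> test \<Rightarrow> (real \<Rightarrow> real) \<Rightarrow> real" where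
  "type_II_error M \<xi> \<sigma> \<phi> n K f =
     measure M {\<omega> \<in> space M. \<not> K (observation \<sigma> \<xi> n (coeffs_of \<phi> f) \<omega>)}"

text \<open>
  A subsequence of alternatives is given by the indices \<open>m i\<close> and the functions \<open>F i\<close>,
  where \<open>F i\<close> is the alternative for noise level index \<open>m i\<close>.
\<close>

definition consistent_along ::
  "'w measure \<Rightarrow> (nat \<Rightarrow> 'w \<Rightarrow> real) \<Rightarrow> (nat \<Rightarrow> real) \<Rightarrow> (nat \<Rightarrow> real \<Rightarrow> real) \<Rightarrow>
   ((nat \<Rightarrow> real) \<Rightarrow> real) \<Rightarrow> (nat \<Rightarrow> nat) \<Rightarrow> (nat \<Rightarrow> real \<Rightarrow> real) \<Rightarrow> bool" where
  "consistent_along M \<xi> \<sigma> \<phi> T m F \<longleftrightarrow>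
     (\<forall>\<alpha>\<in>{0<..<1}. \<forall>K. (\<forall>n. generated_by T (K n)) \<longrightarrow>
        (\<exists>\<epsilon>. \<epsilon> \<longlonglongrightarrow> 0 \<and> (\<forall>i. type_I_error M \<xi> \<sigma> (m i) (K (m i)) = \<alpha> * (1 + \<epsilon> i))) \<longrightarrow>
        limsup (\<lambda>i. ereal (type_II_error M \<xi> \<sigma> \<phi> (m i) (K (m i)) (F i))) < ereal (1 - \<alpha>))"

definition inconsistent_along ::
  "'w measure \<Rightarrow> (nat \<Rightarrow> 'w \<Rightarrow> real) \<Rightarrow> (nat \<Rightarrow> real) \<Rightarrow> (nat \<Rightarrow> real \<Rightarrow> real) \<Rightarrow>
   ((nat \<Rightarrow> real) \<Rightarrow> real) \<Rightarrow> (nat \<Rightarrow> nat) \<Rightarrow> (nat \<Rightarrow> real \<Rightarrow> real) \<Rightarrow> bool" where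
  "inconsistent_along M \<xi> \<sigma> \<phi> T m F \<longleftrightarrow>
     (\<forall>K. (\<forall>n. generated_by T (K n)) \<longrightarrow>
        liminf (\<lambda>i. ereal (type_I_error M \<xi> \<sigma> (m i) (K (m i)) +
                           type_II_error M \<xi> \<sigma> \<phi> (m i) (K (m i)) (F i))) \<ge> 1)"

definition norm_rate_between ::
  "real \<Rightarrow> real \<Rightarrow> real \<Rightarrow> (nat \<Rightarrow> nat) \<Rightarrow> (nat \<Rightarrow> real \<Rightarrow> real) \<Rightarrow> bool" where
  "norm_rate_between r c C m F \<longleftrightarrow>
     (\<forall>i. c * real (m i) powr (- r) < L2_norm (F i) \<and> L2_norm (F i) < C * real (m i) powr (- r))"

end

theory Submission
  imports Defs
begin

text \<open>
  Write \<open>Q a\<close> for the sum of \<open>(\<kappa> j)\<^sup>2 * (a j + \<sigma> j * \<xi> j)\<^sup>2\<close>. At sample size \<open>n\<close> the statistic has the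
  value \<open>Q a / n\<close> with \<open>a = sqrt n * \<theta>\<close>, so an alternative whose norm is of order \<open>1 / sqrt n\<close>
  is a shift \<open>a\<close> whose norm is of order \<open>1\<close>, and a test generated by the statistic accepts when
  \<open>Q a \<le> t\<close> for some threshold \<open>t\<close>. Everything is a comparison of the distribution functions of \<open>Q a\<close>
  and \<open>Q 0\<close>. The tool is conditioning on all noise variables but one (\<open>condition_on_rest\<close>), which
  leaves the probability that a shifted normal variable falls into a symmetric window.

  Consistency rests on Anderson's inequality. The probability of a window decreases strictly in
  the size of the shift (\<open>window_strict_antimono\<close>), so \<open>P (Q a \<le> t)\<close> increases when coordinates of
  \<open>a\<close> are shrunk (\<open>level_antimono\<close>). If \<open>a\<close> lives on the first \<open>l\<close> coordinates and its norm
  exceeds \<open>c\<close>, some coordinate is at least \<open>c / sqrt l\<close>, and shrinking the others to \<open>0\<close> leaves a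
  shift along one of \<open>l\<close> axes. Such a shift lowers the distribution function by a fixed amount as
  long as the null probability stays away from \<open>0\<close> and \<open>1\<close> (\<open>single_shift_gap\<close>,
  \<open>finite_support_gap\<close>). A prescribed asymptotic level \<open>\<alpha>\<close> guarantees this, and the type II
  error stays below \<open>1 - \<alpha>\<close> by that amount.

  For inconsistency, an \<open>f\<close> outside \<open>\<Xi>\<close> has nonzero coefficients of arbitrarily large index. By
  convexity and symmetry, \<open>V\<close> contains a segment around \<open>0\<close> on each of the corresponding axes
  (\<open>ortho_symmetric_convex_contains_axis\<close>). The alternatives \<open>\<phi> (k i) / sqrt (m i)\<close>, with \<open>k i\<close>
  tending to infinity and \<open>m i\<close> large enough, therefore lie in \<open>V\<close>. They correspond to unit shifts
  of the coordinate \<open>k i\<close>, and these move \<open>Q 0\<close> only by an amount of order \<open>(\<kappa> (k i))\<^sup>2\<close>, which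
  tends to \<open>0\<close>. Since the law of \<open>Q 0\<close> puts uniformly little mass on short intervals
  (\<open>concentration\<close>), the distribution functions merge uniformly in \<open>t\<close>, and no choice of thresholds
  brings the sum of the errors below \<open>1\<close> in the limit.
\<close>

section \<open>The standard normal law\<close>

abbreviation std_normal :: "real measure" where
  "std_normal \<equiv> density lborel std_normal_density"

definition window :: "real \<Rightarrow> real \<Rightarrow> real" where
  "window x u = measure std_normal {y. \<bar>x + y\<bar> \<le> u}"

lemma prob_space_std_normal: "prob_space std_normal"
  by (rule prob_space_normal_density) simp

text \<open>
  The normal distribution function enters only through its derivative and its increments, so any
  antiderivative of the density serves; monotonicity of a window probability in the shift is then
  the sign of a derivative.
\<close>

lemma std_normal_antiderivative:
  obtains F where "\<And>x. (F has_real_derivative std_normal_density x) (at x)"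
    and "\<And>a b. a \<le> b \<Longrightarrow> measure std_normal {a..b} = F b - F a"
proof -
  have "isCont std_normal_density x" for x
    unfolding std_normal_density_def by (intro continuous_intros) auto
  then obtain F where F: "\<And>x. (F has_vector_derivative std_normal_density x) (at x)"
    using einterval_antiderivative[of "-\<infinity>" "\<infinity>" std_normal_density] by auto
  have F': "(F has_real_derivative std_normal_density x) (at x)" for x
    using F by (simp add: has_real_derivative_iff_has_vector_derivative)
  have "measure std_normal {a..b} = F b - F a" if "a \<le> b" for a b
  proof -
    have "F a \<le> F b"
      using that by (rule DERIV_nonneg_imp_nondecreasing) (rule exI, rule conjI, rule F', rule normal_density_nonneg)
    moreover have "emeasure std_normal {a..b} = F b - F a"
      using that by (subst emeasure_density) (auto intro!: nn_integral_FTC_Icc F')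
    ultimately show ?thesis
      by (simp add: measure_def)
  qed
  with F' show thesis by (rule that)
qed

lemma window_eq_increment:
  assumes F: "\<And>a b. a \<le> b \<Longrightarrow> measure std_normal {a..b} = F b - F a" and "0 \<le> u"
  shows "window x u = F (u - x) - F (- u - x)"
proof -
  have "{y. \<bar>x + y\<bar> \<le> u} = {- u - x..u - x}" by auto
  with assms show ?thesis by (simp add: window_def)
qed

lemma std_normal_density_even: "std_normal_density (- x) = std_normal_density x"
  by (simp add: std_normal_density_def)

lemma std_normal_density_less:
  "std_normal_density x < std_normal_density y" if "\<bar>y\<bar> < \<bar>x\<bar>"
proof -
  have "y\<^sup>2 < x\<^sup>2" using that by (metis abs_ge_zero power2_abs power_strict_mono zero_less_numeral)
  then show ?thesis by (simp add: std_normal_density_def divide_strict_right_mono)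
qed

lemma std_normal_density_le_1: "std_normal_density x \<le> 1"
proof -
  have "exp (- x\<^sup>2 / 2) \<le> 1" by simp
  moreover have "1 \<le> sqrt (2 * pi)" using pi_ge_two by simp
  ultimately show ?thesis
    unfolding std_normal_density_def by (intro mult_le_one) (auto simp: divide_le_eq)
qed

lemma window_negative_width: "u < 0 \<Longrightarrow> window x u = 0"
proof -
  assume "u < 0"
  then have "{y. \<bar>x + y\<bar> \<le> u} = {}" by (auto simp: not_le intro: less_le_trans[OF _ abs_ge_zero])
  then show ?thesis by (simp add: window_def)
qed

lemma window_minus: "window (- x) u = window x u"
proof (cases "0 \<le> u")
  case True
  obtain F where F: "\<And>x. (F has_real_derivative std_normal_density x) (at x)"
    "\<And>a b. a \<le> b \<Longrightarrow> measure std_normal {a..b} = F b - F a"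
    by (fact std_normal_antiderivative)
  have "DERIV (\<lambda>y. F y + F (- y)) y :> 0" for y
    by (auto intro!: derivative_eq_intros F(1)[THEN DERIV_chain2] simp: std_normal_density_even)
  then have c: "F y + F (- y) = F 0 + F (- 0)" for y
    by (intro DERIV_isconst_all[of "\<lambda>y. F y + F (- y)"]) simp
  show ?thesis
    using c[of "u - x"] c[of "u + x"] True by (simp add: window_eq_increment[OF F(2)] algebra_simps)
next
  case False
  then show ?thesis by (simp add: window_negative_width)
qed

text \<open>
  Anderson's inequality on the line. The derivative in the shift \<open>y\<close> is
  \<open>std_normal_density (u + y) - std_normal_density (u - y)\<close>, which is negative for \<open>y > 0\<close>
  because \<open>u + y\<close> is then farther from the origin than \<open>u - y\<close>.
\<close>

lemma window_strict_antimono: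
  assumes "0 < u" "0 \<le> x" "x < z"
  shows "window z u < window x u"
proof -
  obtain F where F: "\<And>x. (F has_real_derivative std_normal_density x) (at x)"
    "\<And>a b. a \<le> b \<Longrightarrow> measure std_normal {a..b} = F b - F a"
    by (fact std_normal_antiderivative)
  define g where "g y = F (u - y) - F (- u - y)" for y
  have g: "DERIV g y :> std_normal_density (- u - y) - std_normal_density (u - y)" for y
    unfolding g_def by (auto intro!: derivative_eq_intros F(1)[THEN DERIV_chain2])
  have "g z < g x"
  proof (rule DERIV_neg_imp_decreasing_open[OF \<open>x < z\<close>])
    fix y assume "x < y" "y < z"
    then have "\<bar>u - y\<bar> < \<bar>- u - y\<bar>" using assms by auto
    then have "std_normal_density (- u - y) < std_normal_density (u - y)"
      by (rule std_normal_density_less)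
    then show "\<exists>D. DERIV g y :> D \<and> D < 0"
      using g[of y] by (intro exI[of _ "std_normal_density (- u - y) - std_normal_density (u - y)"]) simp
  qed (auto intro!: continuous_at_imp_continuous_on DERIV_isCont g)
  then show ?thesis using \<open>0 < u\<close> by (simp add: g_def window_eq_increment[OF F(2)])
qed

lemma window_antimono_abs:
  assumes "\<bar>x\<bar> \<le> \<bar>z\<bar>"
  shows "window z u \<le> window x u"
proof -
  have abs: "window \<bar>y\<bar> u = window y u" for y using window_minus[of y u] by (cases "0 \<le> y") auto
  consider "u < 0" | "u = 0" | "0 < u" by linarith
  then have "window \<bar>z\<bar> u \<le> window \<bar>x\<bar> u"
  proof cases
    case 1
    then show ?thesis by (simp add: window_negative_width)
  next
    case 2
    obtain F where "\<And>x. (F has_real_derivative std_normal_density x) (at x)"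
      and F: "\<And>a b. a \<le> b \<Longrightarrow> measure std_normal {a..b} = F b - F a"
      by (fact std_normal_antiderivative)
    from window_eq_increment[OF F] 2 show ?thesis by simp
  next
    case 3
    then show ?thesis using window_strict_antimono[OF 3 _ , of "\<bar>x\<bar>" "\<bar>z\<bar>"] assms
      by (cases "\<bar>x\<bar> = \<bar>z\<bar>") auto
  qed
  then show ?thesis by (simp add: abs)
qed

text \<open>
  The loss caused by a shift is continuous in the width of the window and positive, so it has a
  positive minimum over a compact range of widths. The range has to stay away from \<open>0\<close>: the
  loss vanishes with the width.
\<close>

lemma window_gap:
  assumes "0 < c" "0 < u" "u \<le> v"
  obtains \<delta> where "0 < \<delta>" "\<And>w. u \<le> w \<Longrightarrow> w \<le> v \<Longrightarrow> window c w + \<delta> \<le> window 0 w"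
proof -
  obtain F where F: "\<And>x. (F has_real_derivative std_normal_density x) (at x)"
    "\<And>a b. a \<le> b \<Longrightarrow> measure std_normal {a..b} = F b - F a"
    by (fact std_normal_antiderivative)
  have cont: "continuous_on S F" for S
    by (auto intro!: continuous_at_imp_continuous_on DERIV_isCont F)
  have contF: "continuous_on S (\<lambda>w. F (h w))" if "continuous_on S h" for S and h :: "real \<Rightarrow> real"
    using that by (rule continuous_on_compose2[OF cont[of UNIV]]) auto
  define h where "h w = (F (w - 0) - F (- w - 0)) - (F (w - c) - F (- w - c))" for w
  have "continuous_on {u..v} h"
    unfolding h_def by (intro continuous_intros contF)
  then obtain w0 where w0: "w0 \<in> {u..v}" "\<And>w. w \<in> {u..v} \<Longrightarrow> h w0 \<le> h w"
    using continuous_attains_inf[of "{u..v}" h] \<open>u \<le> v\<close> by auto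
  have h: "h w = window 0 w - window c w" if "w \<in> {u..v}" for w
    using that assms by (simp add: h_def window_eq_increment[OF F(2)])
  have "0 < h w0"
    using h[OF w0(1)] window_strict_antimono[of w0 0 c] w0(1) assms by auto
  moreover have "window c w + h w0 \<le> window 0 w" if "u \<le> w" "w \<le> v" for w
    using h[of w] w0(2)[of w] that by simp
  ultimately show thesis by (rule that)
qed

lemma std_normal_interval_le:
  assumes "a \<le> b"
  shows "measure std_normal {a..b} \<le> b - a"
proof -
  obtain F where F: "\<And>x. (F has_real_derivative std_normal_density x) (at x)"
    "\<And>a b. a \<le> b \<Longrightarrow> measure std_normal {a..b} = F b - F a"
    by (fact std_normal_antiderivative)
  have "F b - b \<le> F a - a"
    using assms
  proof (rule DERIV_nonpos_imp_nonincreasing)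
    fix x show "\<exists>y. DERIV (\<lambda>x. F x - x) x :> y \<and> y \<le> 0"
      using std_normal_density_le_1[of x]
      by (intro exI[of _ "std_normal_density x - 1"]) (auto intro!: derivative_eq_intros F(1))
  qed
  with F(2)[OF assms] show ?thesis by simp
qed

text \<open>
  The bound is uniform in \<open>s\<close>. It has the order \<open>sqrt \<epsilon>\<close> and not \<open>\<epsilon>\<close> because
  the density of a squared normal variable is unbounded at \<open>0\<close>: there, the condition on the
  square allows an interval of length \<open>2 * sqrt \<epsilon>\<close>.
\<close>

lemma std_normal_square_concentration:
  assumes "0 \<le> \<epsilon>"
  shows "measure std_normal {y. s - \<epsilon> < y\<^sup>2 \<and> y\<^sup>2 \<le> s} \<le> 2 * sqrt \<epsilon>"
proof (cases "0 \<le> s")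
  case False
  then have "{y. s - \<epsilon> < y\<^sup>2 \<and> y\<^sup>2 \<le> s} = {}" by (auto simp: not_le) (smt (verit) zero_le_power2)
  then show ?thesis using assms by (metis measure_empty mult_nonneg_nonneg real_sqrt_ge_zero zero_le_numeral)
next
  case True
  interpret prob_space std_normal by (rule prob_space_std_normal)
  define v w where "v = sqrt s" and "w = sqrt (max 0 (s - \<epsilon>))"
  have "w \<le> v" using assms True by (auto simp: v_def w_def)
  have "sqrt s \<le> sqrt (max 0 (s - \<epsilon>) + \<epsilon>)" by simp
  also have "\<dots> \<le> sqrt (max 0 (s - \<epsilon>)) + sqrt \<epsilon>" using assms by (intro sqrt_add_le_add_sqrt) auto
  finally have vw: "v - w \<le> sqrt \<epsilon>" by (simp add: v_def w_def)
  have "{y. s - \<epsilon> < y\<^sup>2 \<and> y\<^sup>2 \<le> s} \<subseteq> {w..v} \<union> {- v..- w}"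
  proof
    fix y assume "y \<in> {y. s - \<epsilon> < y\<^sup>2 \<and> y\<^sup>2 \<le> s}"
    then have "max 0 (s - \<epsilon>) \<le> y\<^sup>2" "y\<^sup>2 \<le> s" by auto
    then have "w \<le> \<bar>y\<bar>" "\<bar>y\<bar> \<le> v"
      unfolding v_def w_def by (metis real_sqrt_abs real_sqrt_le_iff)+
    then show "y \<in> {w..v} \<union> {- v..- w}" by auto
  qed
  then have "prob {y. s - \<epsilon> < y\<^sup>2 \<and> y\<^sup>2 \<le> s} \<le> prob ({w..v} \<union> {- v..- w})"
    by (intro finite_measure_mono) auto
  also have "\<dots> \<le> prob {w..v} + prob {- v..- w}"
    by (intro measure_Un_le) auto
  also have "\<dots> \<le> (v - w) + (- w - (- v))"
    using \<open>w \<le> v\<close> by (intro add_mono std_normal_interval_le) auto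
  finally show ?thesis using vw by simp
qed

section \<open>Coefficients in an orthonormal basis of $L_2(0,1)$\<close>

lemma L2_measurable: "f \<in> L2 \<Longrightarrow> f \<in> borel_measurable unit_measure"
  by (simp add: L2_def)

lemma L2_mult_integrable:
  assumes "f \<in> L2" "g \<in> L2"
  shows "integrable unit_measure (\<lambda>x. f x * g x)"
proof (rule Bochner_Integration.integrable_bound)
  show "integrable unit_measure (\<lambda>x. (f x)\<^sup>2 + (g x)\<^sup>2)"
    using assms by (simp add: L2_def)
  show "(\<lambda>x. f x * g x) \<in> borel_measurable unit_measure"
    using assms by (intro borel_measurable_times L2_measurable)
  have "\<bar>f x * g x\<bar> \<le> (f x)\<^sup>2 + (g x)\<^sup>2" for x
  proof -
    have "2 * \<bar>f x * g x\<bar> \<le> (f x)\<^sup>2 + (g x)\<^sup>2"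
      using sum_squares_bound[of "\<bar>f x\<bar>" "\<bar>g x\<bar>"] by (simp add: abs_mult)
    then show ?thesis by linarith
  qed
  then show "AE x in unit_measure. norm (f x * g x) \<le> norm ((f x)\<^sup>2 + (g x)\<^sup>2)"
    by (intro AE_I2) simp
qed

lemma L2_lincomb:
  assumes "f \<in> L2" "g \<in> L2"
  shows "(\<lambda>x. a * f x + b * g x) \<in> L2"
proof -
  have "(\<lambda>x. (a * f x + b * g x)\<^sup>2) =
      (\<lambda>x. a\<^sup>2 * (f x * f x) + 2 * a * b * (f x * g x) + b\<^sup>2 * (g x * g x))"
    by (auto simp: power2_eq_square algebra_simps)
  moreover have "integrable unit_measure
      (\<lambda>x. a\<^sup>2 * (f x * f x) + 2 * a * b * (f x * g x) + b\<^sup>2 * (g x * g x))"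
    by (intro Bochner_Integration.integrable_add integrable_mult_right L2_mult_integrable assms)
  moreover have "(\<lambda>x. a * f x + b * g x) \<in> borel_measurable unit_measure"
    using assms[THEN L2_measurable] by simp
  ultimately show ?thesis by (simp add: L2_def)
qed

lemma L2_scale: "f \<in> L2 \<Longrightarrow> (\<lambda>x. a * f x) \<in> L2"
  using L2_lincomb[of f f a 0] by simp

lemma L2_sum:
  fixes \<phi> :: "nat \<Rightarrow> real \<Rightarrow> real"
  assumes "\<And>j. \<phi> j \<in> L2"
  shows "(\<lambda>x. \<Sum>j<N. \<theta> j * \<phi> j x) \<in> L2"
proof (induction N)
  case 0
  show ?case by (simp add: L2_def)
next
  case (Suc N)
  show ?case using L2_lincomb[OF Suc assms[of N], of 1 "\<theta> N"] by simp
qed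

lemma L2_inner_cong_AE:
  assumes "f \<in> L2" "f' \<in> L2" "g \<in> L2" "AE x in unit_measure. f x = f' x"
  shows "L2_inner f g = L2_inner f' g"
  unfolding L2_inner_def
  using assms(4) by (intro integral_cong_AE borel_measurable_times L2_measurable assms) auto

lemma L2_inner_commute: "L2_inner f g = L2_inner g f"
  by (simp add: L2_inner_def mult.commute)

lemma L2_inner_scale: "L2_inner (\<lambda>x. a * f x) g = a * L2_inner f g"
  by (simp add: L2_inner_def mult.assoc)

lemma L2_inner_sum:
  fixes \<phi> :: "nat \<Rightarrow> real \<Rightarrow> real"
  assumes "\<And>j. \<phi> j \<in> L2" "g \<in> L2"
  shows "L2_inner (\<lambda>x. \<Sum>j<N. \<theta> j * \<phi> j x) g = (\<Sum>j<N. \<theta> j * L2_inner (\<phi> j) g)"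
proof -
  have "L2_inner (\<lambda>x. \<Sum>j<N. \<theta> j * \<phi> j x) g
      = (\<integral>x. (\<Sum>j<N. \<theta> j * (\<phi> j x * g x)) \<partial>unit_measure)"
    by (simp add: L2_inner_def sum_distrib_right mult.assoc)
  also have "\<dots> = (\<Sum>j<N. \<integral>x. \<theta> j * (\<phi> j x * g x) \<partial>unit_measure)"
    by (intro Bochner_Integration.integral_sum integrable_mult_right L2_mult_integrable assms)
  finally show ?thesis by (simp add: L2_inner_def)
qed

lemma L2_inner_self_nonneg: "0 \<le> L2_inner f f"
  by (simp add: L2_inner_def)

lemma L2_norm_power2: "(L2_norm f)\<^sup>2 = L2_inner f f"
  by (simp add: L2_norm_def L2_inner_self_nonneg)

lemma L2_norm_eq_0_AE:
  assumes "f \<in> L2" "L2_norm f = 0"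
  shows "AE x in unit_measure. f x = 0"
proof -
  have "(\<integral>x. f x * f x \<partial>unit_measure) = 0"
    using assms(2) by (simp add: L2_norm_def L2_inner_def)
  then have "AE x in unit_measure. f x * f x = 0"
    using integral_nonneg_eq_0_iff_AE[OF L2_mult_integrable[OF assms(1,1)]] by simp
  then show ?thesis by eventually_elim simp
qed

lemma coeffs_of_finite_expansion:
  assumes basis: "L2_orthonormal_basis \<phi>" and f: "f \<in> L2"
    and eq: "AE x in unit_measure. f x = (\<Sum>j<l. \<theta> j * \<phi> j x)"
  shows "coeffs_of \<phi> f j = (if j < l then \<theta> j else 0)"
    and "(L2_norm f)\<^sup>2 = (\<Sum>j<l. (\<theta> j)\<^sup>2)"
proof -
  have \<phi>: "\<And>j. \<phi> j \<in> L2" and orth: "\<And>i j. L2_inner (\<phi> i) (\<phi> j) = (if i = j then 1 else 0)"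
    using basis by (simp_all add: L2_orthonormal_basis_def)
  have inner: "L2_inner f g = (\<Sum>j<l. \<theta> j * L2_inner (\<phi> j) g)" if "g \<in> L2" for g
    using L2_inner_cong_AE[OF f L2_sum[OF \<phi>] that eq] L2_inner_sum[OF \<phi> that] by simp
  have coeff: "coeffs_of \<phi> f j = (if j < l then \<theta> j else 0)" for j
    by (simp add: coeffs_of_def inner[OF \<phi>] orth if_distrib[of "(*) _"] cong: if_cong)
  then show "coeffs_of \<phi> f j = (if j < l then \<theta> j else 0)" .
  have "L2_inner f f = (\<Sum>j<l. \<theta> j * coeffs_of \<phi> f j)"
    by (subst inner[OF f]) (simp add: coeffs_of_def L2_inner_commute[of f])
  then show "(L2_norm f)\<^sup>2 = (\<Sum>j<l. (\<theta> j)\<^sup>2)"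
    by (simp only: L2_norm_power2) (simp add: coeff power2_eq_square)
qed

lemma coeffs_of_scaled_basis:
  assumes "L2_orthonormal_basis \<phi>"
  shows "coeffs_of \<phi> (\<lambda>x. s * \<phi> j x) = (\<lambda>i. if i = j then s else 0)"
    and "L2_norm (\<lambda>x. s * \<phi> j x) = \<bar>s\<bar>"
proof -
  have orth: "\<And>i j. L2_inner (\<phi> i) (\<phi> j) = (if i = j then 1 else 0)"
    using assms by (simp add: L2_orthonormal_basis_def)
  show "coeffs_of \<phi> (\<lambda>x. s * \<phi> j x) = (\<lambda>i. if i = j then s else 0)"
    by (auto simp: coeffs_of_def L2_inner_scale orth)
  show "L2_norm (\<lambda>x. s * \<phi> j x) = \<bar>s\<bar>"
    by (simp add: L2_norm_def L2_inner_scale L2_inner_commute[of "\<phi> j"] orth power2_eq_square[symmetric])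
qed

text \<open>
  If the coefficients vanished from \<open>N\<close> on, the partial sums of the expansion would be constant
  from \<open>N\<close> on, hence equal to \<open>f\<close> almost everywhere, which puts \<open>f\<close> into \<open>\<Xi>\<close>.
\<close>

lemma frequently_nonzero_coeff:
  assumes basis: "L2_orthonormal_basis \<phi>" and exp: "L2_expansion \<phi> \<theta> f" and "f \<notin> Xi_set \<phi>"
  shows "\<exists>j\<ge>N. \<theta> j \<noteq> 0"
proof (rule ccontr)
  assume "\<not> ?thesis"
  then have zero: "\<theta> j = 0" if "N \<le> j" for j using that by auto
  have \<phi>: "\<And>j. \<phi> j \<in> L2" and f: "f \<in> L2"
    using basis exp by (simp_all add: L2_orthonormal_basis_def L2_expansion_def)
  define r where "r x = f x - (\<Sum>j<Suc N. \<theta> j * \<phi> j x)" for x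
  have tail: "(\<Sum>j<K. \<theta> j * \<phi> j x) = (\<Sum>j<Suc N. \<theta> j * \<phi> j x)" if "Suc N \<le> K" for K x
    using that by (intro sum.mono_neutral_right) (auto simp: zero)
  have "L2_norm (\<lambda>x. f x - (\<Sum>j<K. \<theta> j * \<phi> j x)) = L2_norm r" if "Suc N \<le> K" for K
    unfolding r_def[abs_def] tail[OF that] ..
  then have "(\<lambda>K. L2_norm (\<lambda>x. f x - (\<Sum>j<K. \<theta> j * \<phi> j x))) \<longlonglongrightarrow> L2_norm r"
    by (intro tendsto_eventually) (auto simp: eventually_sequentially)
  then have "L2_norm r = 0"
    using exp unfolding L2_expansion_def by (elim conjE) (rule LIMSEQ_unique)
  moreover have "r \<in> L2"
    using L2_lincomb[OF f L2_sum[where N = "Suc N" and \<theta> = \<theta> and \<phi> = \<phi>, OF \<phi>], of 1 "-1"]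
    by (simp add: r_def[abs_def] del: sum.lessThan_Suc)
  ultimately have "AE x in unit_measure. r x = 0"
    by (intro L2_norm_eq_0_AE)
  then have "AE x in unit_measure. f x = (\<Sum>j<Suc N. \<theta> j * \<phi> j x)"
    by eventually_elim (simp add: r_def)
  then have "f \<in> U_set \<phi> (Suc N) (L2_norm f + 1)"
    using f by (auto simp: U_set_def)
  moreover have "0 < L2_norm f + 1"
    by (simp add: L2_norm_def L2_inner_self_nonneg add_nonneg_pos)
  ultimately have "f \<in> Xi_set \<phi>"
    unfolding Xi_set_def by (auto intro!: exI[of _ "Suc N"] exI[of _ "L2_norm f + 1"])
  then show False using assms(3) by simp
qed

lemma L2_norm_minus: "L2_norm (\<lambda>x. - f x) = L2_norm f"
  by (simp add: L2_norm_def L2_inner_def)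

lemma L2_expansion_scaled_basis:
  assumes "L2_orthonormal_basis \<phi>"
  shows "L2_expansion \<phi> (\<lambda>i. if i = j then s else 0) (\<lambda>x. s * \<phi> j x)"
proof -
  have "s * \<phi> j x - (\<Sum>i<K. (if i = j then s else 0) * \<phi> i x) = 0" if "Suc j \<le> K" for K x
    using that by (simp add: if_distrib[of "\<lambda>z. z * _"] cong: if_cong)
  then have "L2_norm (\<lambda>x. s * \<phi> j x - (\<Sum>i<K. (if i = j then s else 0) * \<phi> i x)) = 0"
    if "Suc j \<le> K" for K
    using that by (simp only: L2_norm_def L2_inner_def) simp
  then have "(\<lambda>K. L2_norm (\<lambda>x. s * \<phi> j x - (\<Sum>i<K. (if i = j then s else 0) * \<phi> i x))) \<longlonglongrightarrow> 0"
    by (intro tendsto_eventually) (auto simp: eventually_sequentially)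
  then show ?thesis
    using assms by (simp add: L2_expansion_def L2_scale L2_orthonormal_basis_def)
qed

text \<open>
  Flipping the signs of all coefficients except the \<open>j\<close>-th turns \<open>f\<close> into
  \<open>2 * \<theta> j * \<phi> j - f\<close>. The midpoint of these two elements of \<open>V\<close> is \<open>\<theta> j * \<phi> j\<close>. Flipping
  its sign as well gives the other end of a segment, all of which lies in \<open>V\<close> by convexity.
\<close>

lemma ortho_symmetric_convex_contains_axis:
  assumes basis: "L2_orthonormal_basis \<phi>" and convex: "L2_convex V"
    and sym: "ortho_symmetric \<phi> V" and fV: "f \<in> V" and exp: "L2_expansion \<phi> \<theta> f"
    and s: "\<bar>s\<bar> \<le> \<bar>\<theta> j\<bar>"
  shows "(\<lambda>x. s * \<phi> j x) \<in> V"
proof -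
  have \<phi>: "\<And>j. \<phi> j \<in> L2" and f: "f \<in> L2"
    using basis exp by (simp_all add: L2_orthonormal_basis_def L2_expansion_def)
  define \<theta>' where "\<theta>' i = (if i = j then \<theta> i else - \<theta> i)" for i
  define g where "g x = 2 * \<theta> j * \<phi> j x - f x" for x
  have "g x - (\<Sum>i<K. \<theta>' i * \<phi> i x) = - (f x - (\<Sum>i<K. \<theta> i * \<phi> i x))" if "Suc j \<le> K" for K x
  proof -
    have "(\<Sum>i<K. \<theta>' i * \<phi> i x) = (\<Sum>i<K. (if i = j then 2 * \<theta> j * \<phi> j x else 0) - \<theta> i * \<phi> i x)"
      by (intro sum.cong) (auto simp: \<theta>'_def)
    also have "\<dots> = 2 * \<theta> j * \<phi> j x - (\<Sum>i<K. \<theta> i * \<phi> i x)"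
      using that by (simp add: sum_subtractf)
    finally show ?thesis by (simp add: g_def)
  qed
  then have "L2_norm (\<lambda>x. g x - (\<Sum>i<K. \<theta>' i * \<phi> i x))
      = L2_norm (\<lambda>x. f x - (\<Sum>i<K. \<theta> i * \<phi> i x))" if "Suc j \<le> K" for K
    using that by (simp only: L2_norm_minus)
  then have "\<forall>\<^sub>F K in sequentially. L2_norm (\<lambda>x. f x - (\<Sum>i<K. \<theta> i * \<phi> i x))
      = L2_norm (\<lambda>x. g x - (\<Sum>i<K. \<theta>' i * \<phi> i x))"
    by (auto simp: eventually_sequentially intro!: exI[of _ "Suc j"])
  then have "(\<lambda>K. L2_norm (\<lambda>x. g x - (\<Sum>i<K. \<theta>' i * \<phi> i x))) \<longlonglongrightarrow> 0"
    using exp unfolding L2_expansion_def by (elim conjE) (rule Lim_transform_eventually)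
  moreover have "g \<in> L2"
    using L2_lincomb[OF \<phi>[of j] f, of "2 * \<theta> j" "-1"] by (simp add: g_def[abs_def])
  ultimately have "L2_expansion \<phi> \<theta>' g" by (simp add: L2_expansion_def)
  moreover have "\<forall>i. \<theta>' i \<in> {\<theta> i, - \<theta> i}" by (simp add: \<theta>'_def)
  ultimately have "g \<in> V"
    by (intro sym[unfolded ortho_symmetric_def, rule_format, OF exp fV]) auto
  moreover have "(1 / 2 :: real) \<in> {0..1}" by simp
  ultimately have "(\<lambda>x. (1 - 1 / 2) * f x + 1 / 2 * g x) \<in> V"
    by (intro convex[unfolded L2_convex_def, rule_format, OF fV])
  moreover have "(\<lambda>x. (1 - 1 / 2) * f x + 1 / 2 * g x) = (\<lambda>x. \<theta> j * \<phi> j x)"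
    by (auto simp: g_def field_simps)
  ultimately have plus: "(\<lambda>x. \<theta> j * \<phi> j x) \<in> V" by simp
  have minus: "(\<lambda>x. - \<theta> j * \<phi> j x) \<in> V"
    by (rule sym[unfolded ortho_symmetric_def, rule_format, OF
          L2_expansion_scaled_basis[OF basis, of j "\<theta> j"] plus _
          L2_expansion_scaled_basis[OF basis, of j "- \<theta> j"]]) auto
  show ?thesis
  proof (cases "\<theta> j = 0")
    case True
    with s plus show ?thesis by simp
  next
    case False
    \<comment> \<open>The weight at which the segment from \<open>- \<theta> j\<close> to \<open>\<theta> j\<close> passes through \<open>s\<close>.\<close>
    define t where "t = (s / \<theta> j + 1) / 2"
    have "\<bar>s / \<theta> j\<bar> \<le> 1" using False s by (simp add: abs_divide)
    then have "- 1 \<le> s / \<theta> j" "s / \<theta> j \<le> 1" by linarith+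
    then have "t \<in> {0..1}" by (simp add: t_def)
    then have "(\<lambda>x. (1 - t) * (- \<theta> j * \<phi> j x) + t * (\<theta> j * \<phi> j x)) \<in> V"
      by (rule convex[unfolded L2_convex_def, rule_format, OF minus plus])
    moreover have "(1 - t) * (- \<theta> j * y) + t * (\<theta> j * y) = s * y" for y
    proof -
      have "(1 - t) * (- \<theta> j * y) + t * (\<theta> j * y) = (2 * t - 1) * \<theta> j * y"
        by (simp add: algebra_simps)
      also have "2 * t - 1 = s / \<theta> j" by (simp add: t_def field_simps)
      finally show ?thesis using False by simp
    qed
    ultimately show ?thesis by simp
  qed
qed

section \<open>The weighted quadratic form\<close>

text \<open>
  Fubini's theorem for the joint law of two independent variables: the first one may be frozen
  while the probability over the second one is computed.
\<close>

lemma (in prob_space) prob_indep_pair: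
  assumes indep: "indep_var borel Y borel X" and A: "A \<in> sets (borel \<Otimes>\<^sub>M borel)"
  shows "(\<lambda>\<omega>. prob {\<omega>' \<in> space M. (Y \<omega>, X \<omega>') \<in> A}) \<in> borel_measurable M"
    and "prob {\<omega> \<in> space M. (Y \<omega>, X \<omega>) \<in> A} =
      expectation (\<lambda>\<omega>. prob {\<omega>' \<in> space M. (Y \<omega>, X \<omega>') \<in> A})"
proof -
  have Y: "Y \<in> borel_measurable M" and X: "X \<in> borel_measurable M"
    and joint: "distr M borel Y \<Otimes>\<^sub>M distr M borel X = distr M (borel \<Otimes>\<^sub>M borel) (\<lambda>\<omega>. (Y \<omega>, X \<omega>))"
    using indep by (auto simp: indep_var_distribution_eq)
  interpret X: prob_space "distr M borel X" by (rule prob_space_distr[OF X])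
  have slice: "Pair y -` A \<in> sets borel" for y
    by (rule sets_Pair1[OF A])
  have law: "emeasure (distr M borel X) (Pair y -` A) = prob {\<omega>' \<in> space M. (y, X \<omega>') \<in> A}" for y
    by (subst emeasure_distr[OF X slice]) (auto simp: emeasure_eq_measure vimage_def Int_def conj_commute)
  have A': "A \<in> sets (distr M borel Y \<Otimes>\<^sub>M distr M borel X)" using A by simp
  have "(\<lambda>y. emeasure (distr M borel X) (Pair y -` A)) \<in> borel_measurable (distr M borel Y)"
    by (rule X.measurable_emeasure_Pair) (use A in simp)
  then have "(\<lambda>y. enn2real (emeasure (distr M borel X) (Pair y -` A))) \<in> borel_measurable borel"
    by simp
  then have meas: "(\<lambda>y. prob {\<omega>' \<in> space M. (y, X \<omega>') \<in> A}) \<in> borel_measurable borel"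
    by (simp add: law)
  then show meas': "(\<lambda>\<omega>. prob {\<omega>' \<in> space M. (Y \<omega>, X \<omega>') \<in> A}) \<in> borel_measurable M"
    by (rule measurable_compose[OF Y])
  have "emeasure M {\<omega> \<in> space M. (Y \<omega>, X \<omega>) \<in> A}
      = emeasure (distr M (borel \<Otimes>\<^sub>M borel) (\<lambda>\<omega>. (Y \<omega>, X \<omega>))) A"
    by (subst emeasure_distr[OF measurable_Pair[OF Y X] A])
      (auto simp: vimage_def Int_def conj_commute)
  also have "\<dots> = (\<integral>\<^sup>+y. emeasure (distr M borel X) (Pair y -` A) \<partial>distr M borel Y)"
    unfolding joint[symmetric] by (rule X.emeasure_pair_measure_alt[OF A'])
  also have "\<dots> = (\<integral>\<^sup>+\<omega>. prob {\<omega>' \<in> space M. (Y \<omega>, X \<omega>') \<in> A} \<partial>M)"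
    unfolding law by (rule nn_integral_distr[OF Y]) (use meas in simp)
  finally have "enn2real (emeasure M {\<omega> \<in> space M. (Y \<omega>, X \<omega>) \<in> A})
      = enn2real (\<integral>\<^sup>+\<omega>. prob {\<omega>' \<in> space M. (Y \<omega>, X \<omega>') \<in> A} \<partial>M)" by simp
  then show "prob {\<omega> \<in> space M. (Y \<omega>, X \<omega>) \<in> A} =
      expectation (\<lambda>\<omega>. prob {\<omega>' \<in> space M. (Y \<omega>, X \<omega>') \<in> A})"
    by (subst integral_eq_nn_integral[OF meas']) (auto simp: measure_def)
qed

locale gaussian_sequence_model =
  fixes M :: "'w measure" and \<xi> :: "nat \<Rightarrow> 'w \<Rightarrow> real" and \<kappa> \<sigma> :: "nat \<Rightarrow> real"
  assumes noise: "standard_gaussian_noise M \<xi>" and D1: "D1 \<kappa>" and D2: "D2 \<sigma>"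

sublocale gaussian_sequence_model \<subseteq> prob_space M
  using noise by (simp add: standard_gaussian_noise_def)

context gaussian_sequence_model
begin

lemma noise_measurable [measurable]: "\<xi> j \<in> borel_measurable M"
  using noise by (auto simp: standard_gaussian_noise_def distributed_def)

lemma distributed_noise: "distributed M lborel (\<xi> j) std_normal_density"
  using noise by (simp add: standard_gaussian_noise_def)

lemma noise_law:
  assumes "{y. P y} \<in> sets borel"
  shows "prob {\<omega> \<in> space M. P (\<xi> j \<omega>)} = measure std_normal {y. P y}"
proof -
  have "prob {\<omega> \<in> space M. P (\<xi> j \<omega>)} = measure (distr M lborel (\<xi> j)) {y. P y}"
    using assms by (subst measure_distr) (auto intro!: arg_cong[where f = prob])
  then show ?thesis using distributed_noise by (simp add: distributed_def)
qed

lemma kappa_pos: "0 < (\<kappa> j)\<^sup>2" and kappa_summable: "summable (\<lambda>j. (\<kappa> j)\<^sup>2)"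
  using D1 by (simp_all add: D1_def)

lemma kappa_nonzero: "\<kappa> j \<noteq> 0"
  using kappa_pos[of j] by auto

lemma sigma_pos: "0 < \<sigma> j"
  using D2 by (auto simp: D2_def)

lemma noise_moments:
  shows "integrable M (\<xi> j)" "expectation (\<xi> j) = 0"
    "integrable M (\<lambda>\<omega>. (\<xi> j \<omega>)\<^sup>2)" "expectation (\<lambda>\<omega>. (\<xi> j \<omega>)\<^sup>2) = 1"
proof -
  have *: "integrable M (\<lambda>\<omega>. (\<xi> j \<omega>) ^ k)" for k
    using integrable_std_normal_moment[of k] distributed_integrable[OF distributed_noise, of "\<lambda>x. x ^ k" j]
    by simp
  show "integrable M (\<xi> j)" using *[of 1] by simp
  show "integrable M (\<lambda>\<omega>. (\<xi> j \<omega>)\<^sup>2)" by (rule *)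
  show "expectation (\<xi> j) = 0"
    using distributed_integral[OF distributed_noise, of "\<lambda>x. x" j] integral_std_normal_moment_odd[of 0]
    by simp
  show "expectation (\<lambda>\<omega>. (\<xi> j \<omega>)\<^sup>2) = 1"
    using distributed_integral[OF distributed_noise, of "\<lambda>x. x\<^sup>2" j] integral_std_normal_moment_even[of 1]
    by simp
qed

text \<open>
  After multiplication by \<open>n\<close>, the statistic at the alternative \<open>\<theta>\<close> becomes the form \<open>Q a\<close> with
  the shift \<open>a = sqrt n * \<theta>\<close>, in which the sample size no longer occurs.
\<close>

definition Q :: "(nat \<Rightarrow> real) \<Rightarrow> 'w \<Rightarrow> real" where
  "Q a \<omega> = (\<Sum>j. (\<kappa> j)\<^sup>2 * (a j + \<sigma> j * \<xi> j \<omega>)\<^sup>2)"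

text \<open>
  A series of its own, and not the difference of \<open>Q a\<close> and its \<open>j\<close>-th term, so that it visibly
  depends only on the noise variables other than \<open>\<xi> j\<close>.
\<close>

definition rest :: "nat \<Rightarrow> (nat \<Rightarrow> real) \<Rightarrow> 'w \<Rightarrow> real" where
  "rest j a \<omega> = (\<Sum>i. if i = j then 0 else (\<kappa> i)\<^sup>2 * (a i + \<sigma> i * \<xi> i \<omega>)\<^sup>2)"

lemma Q_measurable [measurable]: "Q a \<in> borel_measurable M"
  unfolding Q_def[abs_def] by measurable

lemma rest_measurable [measurable]: "rest j a \<in> borel_measurable M"
  unfolding rest_def[abs_def] by measurable

text \<open>
  The terms are nonnegative and their expectations \<open>(\<kappa> j)\<^sup>2 * (\<sigma> j)\<^sup>2\<close> are summable, so the
  sum has finite expectation and therefore is finite almost surely.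
\<close>

lemma AE_summable_noise: "AE \<omega> in M. summable (\<lambda>j. (\<kappa> j)\<^sup>2 * (\<sigma> j * \<xi> j \<omega>)\<^sup>2)"
proof -
  obtain C where C: "0 < C" "\<And>j. 0 < \<sigma> j" "\<And>j. \<sigma> j < C"
    using D2 by (auto simp: D2_def)
  have bound: "\<integral>\<^sup>+\<omega>. ennreal ((\<kappa> j)\<^sup>2 * (\<sigma> j * \<xi> j \<omega>)\<^sup>2) \<partial>M \<le> ennreal ((\<kappa> j)\<^sup>2 * C\<^sup>2)" for j
  proof -
    have "(\<integral>\<^sup>+\<omega>. ennreal ((\<kappa> j)\<^sup>2 * (\<sigma> j * \<xi> j \<omega>)\<^sup>2) \<partial>M)
        = ennreal (expectation (\<lambda>\<omega>. ((\<kappa> j)\<^sup>2 * (\<sigma> j)\<^sup>2) * (\<xi> j \<omega>)\<^sup>2))"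
      by (subst nn_integral_eq_integral[symmetric])
        (auto intro!: noise_moments simp: power_mult_distrib mult.assoc)
    also have "\<dots> = ennreal ((\<kappa> j)\<^sup>2 * (\<sigma> j)\<^sup>2)"
      by (simp add: noise_moments)
    also have "\<dots> \<le> ennreal ((\<kappa> j)\<^sup>2 * C\<^sup>2)"
      using C(2,3)[of j] by (intro ennreal_leI mult_left_mono power_mono) auto
    finally show ?thesis .
  qed
  have "(\<integral>\<^sup>+\<omega>. (\<Sum>j. ennreal ((\<kappa> j)\<^sup>2 * (\<sigma> j * \<xi> j \<omega>)\<^sup>2)) \<partial>M)
      = (\<Sum>j. \<integral>\<^sup>+\<omega>. ennreal ((\<kappa> j)\<^sup>2 * (\<sigma> j * \<xi> j \<omega>)\<^sup>2) \<partial>M)"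
    by (rule nn_integral_suminf) simp
  also have "\<dots> \<le> (\<Sum>j. ennreal ((\<kappa> j)\<^sup>2 * C\<^sup>2))"
    by (intro suminf_le bound) auto
  also have "\<dots> = ennreal (\<Sum>j. (\<kappa> j)\<^sup>2 * C\<^sup>2)"
    by (intro suminf_ennreal2 summable_mult2 kappa_summable) auto
  finally have "(\<integral>\<^sup>+\<omega>. (\<Sum>j. ennreal ((\<kappa> j)\<^sup>2 * (\<sigma> j * \<xi> j \<omega>)\<^sup>2)) \<partial>M) \<noteq> \<infinity>"
    by (auto simp: top_unique)
  then have "AE \<omega> in M. (\<Sum>j. ennreal ((\<kappa> j)\<^sup>2 * (\<sigma> j * \<xi> j \<omega>)\<^sup>2)) \<noteq> \<infinity>"
    by (intro nn_integral_PInf_AE) auto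
  then show ?thesis
    by eventually_elim (intro summable_suminf_not_top, auto)
qed

definition weighted_l2 :: "(nat \<Rightarrow> real) \<Rightarrow> bool" where
  "weighted_l2 a \<longleftrightarrow> summable (\<lambda>j. (\<kappa> j)\<^sup>2 * (a j)\<^sup>2)"

lemma weighted_l2_finite: "finite A \<Longrightarrow> (\<And>j. j \<notin> A \<Longrightarrow> a j = 0) \<Longrightarrow> weighted_l2 a"
  unfolding weighted_l2_def by (rule summable_finite[of A]) auto

lemma weighted_l2_mono:
  assumes "weighted_l2 a" "\<And>j. \<bar>b j\<bar> \<le> \<bar>a j\<bar>"
  shows "weighted_l2 b"
  unfolding weighted_l2_def
proof (rule summable_comparison_test)
  show "summable (\<lambda>j. (\<kappa> j)\<^sup>2 * (a j)\<^sup>2)" using assms(1) by (simp add: weighted_l2_def)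
  have "(b j)\<^sup>2 \<le> (a j)\<^sup>2" for j using assms(2) by (simp add: abs_le_square_iff)
  then show "\<exists>N. \<forall>n\<ge>N. norm ((\<kappa> n)\<^sup>2 * (b n)\<^sup>2) \<le> (\<kappa> n)\<^sup>2 * (a n)\<^sup>2"
    by (auto intro!: mult_left_mono)
qed

lemma AE_summable_Q:
  assumes "weighted_l2 a"
  shows "AE \<omega> in M. summable (\<lambda>j. (\<kappa> j)\<^sup>2 * (a j + \<sigma> j * \<xi> j \<omega>)\<^sup>2)"
  using AE_summable_noise
proof eventually_elim
  case (elim \<omega>)
  let ?b = "\<lambda>j. 2 * ((\<kappa> j)\<^sup>2 * (a j)\<^sup>2) + 2 * ((\<kappa> j)\<^sup>2 * (\<sigma> j * \<xi> j \<omega>)\<^sup>2)"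
  have "norm ((\<kappa> j)\<^sup>2 * (a j + \<sigma> j * \<xi> j \<omega>)\<^sup>2) \<le> ?b j" for j
  proof -
    have "(a j + \<sigma> j * \<xi> j \<omega>)\<^sup>2 \<le> 2 * (a j)\<^sup>2 + 2 * (\<sigma> j * \<xi> j \<omega>)\<^sup>2"
      using sum_squares_bound[of "a j" "\<sigma> j * \<xi> j \<omega>"] by (simp add: power2_sum)
    from mult_left_mono[OF this zero_le_power2[of "\<kappa> j"]] show ?thesis by (simp add: algebra_simps)
  qed
  moreover have "summable ?b"
    using assms elim unfolding weighted_l2_def by (intro summable_add summable_mult)
  ultimately show ?case by (blast intro: summable_comparison_test')
qed

lemma AE_Q_split:
  assumes "weighted_l2 a"
  shows "AE \<omega> in M. Q a \<omega> = (\<kappa> j)\<^sup>2 * (a j + \<sigma> j * \<xi> j \<omega>)\<^sup>2 + rest j a \<omega> \<and> 0 \<le> rest j a \<omega>"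
  using AE_summable_Q[OF assms]
proof eventually_elim
  case (elim \<omega>)
  let ?f = "\<lambda>i. (\<kappa> i)\<^sup>2 * (a i + \<sigma> i * \<xi> i \<omega>)\<^sup>2"
  have "(\<lambda>i. ?f i - (if i = j then ?f i else 0)) sums (Q a \<omega> - ?f j)"
    using sums_diff[OF summable_sums[OF elim] sums_single[of j ?f]] by (simp add: Q_def)
  moreover have "(\<lambda>i. ?f i - (if i = j then ?f i else 0)) = (\<lambda>i. if i = j then 0 else ?f i)"
    by auto
  ultimately have sums: "(\<lambda>i. if i = j then 0 else ?f i) sums (Q a \<omega> - ?f j)" by simp
  have "rest j a \<omega> = Q a \<omega> - ?f j"
    unfolding rest_def by (rule sums_unique[OF sums, symmetric])
  moreover have "0 \<le> Q a \<omega> - ?f j"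
    by (rule sums_le[OF _ sums_zero sums]) auto
  ultimately show ?case by simp
qed

lemma indep_rest_noise: "indep_var borel (rest j a) borel (\<xi> j)"
proof -
  have "indep_vars (\<lambda>_. borel) \<xi> UNIV"
    using noise by (simp add: standard_gaussian_noise_def)
  then have "indep_var (PiM (- {j}) (\<lambda>_. borel)) (\<lambda>\<omega>. restrict (\<lambda>i. \<xi> i \<omega>) (- {j}))
      (PiM {j} (\<lambda>_. borel)) (\<lambda>\<omega>. restrict (\<lambda>i. \<xi> i \<omega>) {j})"
    by (rule indep_var_restrict) auto
  then have "indep_var borel
      ((\<lambda>z. \<Sum>i. if i = j then 0 else (\<kappa> i)\<^sup>2 * (a i + \<sigma> i * z i)\<^sup>2) \<circ> (\<lambda>\<omega>. restrict (\<lambda>i. \<xi> i \<omega>) (- {j})))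
      borel ((\<lambda>z. z j) \<circ> (\<lambda>\<omega>. restrict (\<lambda>i. \<xi> i \<omega>) {j}))"
  proof (rule indep_var_compose)
    have "(\<lambda>z. if i = j then 0 else (\<kappa> i)\<^sup>2 * (a i + \<sigma> i * z i)\<^sup>2)
        \<in> borel_measurable (PiM (- {j}) (\<lambda>_. borel))" for i
      by (cases "i = j") (auto intro!: borel_measurable_times borel_measurable_power borel_measurable_add)
    then show "(\<lambda>z. \<Sum>i. if i = j then 0 else (\<kappa> i)\<^sup>2 * (a i + \<sigma> i * z i)\<^sup>2)
        \<in> borel_measurable (PiM (- {j}) (\<lambda>_. borel))"
      by (rule borel_measurable_suminf)
  qed simp
  moreover have "(\<lambda>z. \<Sum>i. if i = j then 0 else (\<kappa> i)\<^sup>2 * (a i + \<sigma> i * z i)\<^sup>2)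
      \<circ> (\<lambda>\<omega>. restrict (\<lambda>i. \<xi> i \<omega>) (- {j})) = rest j a"
    by (auto simp: fun_eq_iff rest_def intro!: arg_cong[where f = suminf])
  moreover have "(\<lambda>z. z j) \<circ> (\<lambda>\<omega>. restrict (\<lambda>i. \<xi> i \<omega>) {j}) = \<xi> j"
    by auto
  ultimately show ?thesis by simp
qed

text \<open>
  This reduces statements about the law of \<open>Q a\<close> to statements about a single normal variable:
  all coordinates but the \<open>j\<close>-th are frozen.
\<close>

lemma condition_on_rest:
  assumes a: "weighted_l2 a" and P: "Measurable.pred borel P"
  shows "(\<lambda>\<omega>. prob {\<omega>' \<in> space M. P ((\<kappa> j)\<^sup>2 * (a j + \<sigma> j * \<xi> j \<omega>')\<^sup>2 + rest j a \<omega>)}) \<in> borel_measurable M"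
    and "prob {\<omega> \<in> space M. P (Q a \<omega>)} =
      expectation (\<lambda>\<omega>. prob {\<omega>' \<in> space M. P ((\<kappa> j)\<^sup>2 * (a j + \<sigma> j * \<xi> j \<omega>')\<^sup>2 + rest j a \<omega>)})"
proof -
  note P [measurable]
  define A where "A = {(r, x). P ((\<kappa> j)\<^sup>2 * (a j + \<sigma> j * x)\<^sup>2 + r)}"
  have "Measurable.pred (borel \<Otimes>\<^sub>M borel) (\<lambda>(r, x). P ((\<kappa> j)\<^sup>2 * (a j + \<sigma> j * x)\<^sup>2 + r))"
    by measurable
  then have A: "A \<in> sets (borel \<Otimes>\<^sub>M borel)"
    by (simp add: A_def pred_def space_pair_measure)
  note pair = prob_indep_pair[OF indep_rest_noise A]
  show "(\<lambda>\<omega>. prob {\<omega>' \<in> space M. P ((\<kappa> j)\<^sup>2 * (a j + \<sigma> j * \<xi> j \<omega>')\<^sup>2 + rest j a \<omega>)}) \<in> borel_measurable M"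
    using pair(1)[of j a] by (simp add: A_def)
  have "prob {\<omega> \<in> space M. P (Q a \<omega>)} = prob {\<omega> \<in> space M. (rest j a \<omega>, \<xi> j \<omega>) \<in> A}"
  proof (rule finite_measure_eq_AE)
    show "AE \<omega> in M. \<omega> \<in> {\<omega> \<in> space M. P (Q a \<omega>)} \<longleftrightarrow> \<omega> \<in> {\<omega> \<in> space M. (rest j a \<omega>, \<xi> j \<omega>) \<in> A}"
      using AE_Q_split[OF a, of j] by eventually_elim (simp add: A_def)
    show "{\<omega> \<in> space M. (rest j a \<omega>, \<xi> j \<omega>) \<in> A} \<in> events"
      unfolding A_def by simp
  qed measurable
  then show "prob {\<omega> \<in> space M. P (Q a \<omega>)} =
      expectation (\<lambda>\<omega>. prob {\<omega>' \<in> space M. P ((\<kappa> j)\<^sup>2 * (a j + \<sigma> j * \<xi> j \<omega>')\<^sup>2 + rest j a \<omega>)})"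
    using pair(2)[of j a] by (simp add: A_def)
qed

section \<open>Comparing quadratic forms with different shifts\<close>

lemma weight_pos: "0 < (\<kappa> j)\<^sup>2 * (\<sigma> j)\<^sup>2"
  by (intro mult_pos_pos kappa_pos zero_less_power sigma_pos)

definition level :: "(nat \<Rightarrow> real) \<Rightarrow> real \<Rightarrow> real" where
  "level a t = prob {\<omega> \<in> space M. Q a \<omega> \<le> t}"

definition coord :: "nat \<Rightarrow> real \<Rightarrow> real \<Rightarrow> real" where
  "coord j x s = prob {\<omega> \<in> space M. (\<kappa> j)\<^sup>2 * (x + \<sigma> j * \<xi> j \<omega>)\<^sup>2 \<le> s}"

lemma coord_eq_window:
  assumes "0 \<le> s"
  shows "coord j x s = window (x / \<sigma> j) (sqrt (s / ((\<kappa> j)\<^sup>2 * (\<sigma> j)\<^sup>2)))"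
proof -
  have "(\<kappa> j)\<^sup>2 * (x + \<sigma> j * y)\<^sup>2 \<le> s \<longleftrightarrow> \<bar>x / \<sigma> j + y\<bar> \<le> sqrt (s / ((\<kappa> j)\<^sup>2 * (\<sigma> j)\<^sup>2))" for y
  proof -
    have "(x + \<sigma> j * y)\<^sup>2 = (\<sigma> j)\<^sup>2 * (x / \<sigma> j + y)\<^sup>2"
      using sigma_pos[of j] by (simp add: power_mult_distrib[symmetric] distrib_left)
    then have "(\<kappa> j)\<^sup>2 * (x + \<sigma> j * y)\<^sup>2 \<le> s \<longleftrightarrow> (x / \<sigma> j + y)\<^sup>2 \<le> s / ((\<kappa> j)\<^sup>2 * (\<sigma> j)\<^sup>2)"
      using kappa_pos[of j] sigma_pos[of j] by (simp add: pos_le_divide_eq ac_simps)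
    also have "\<dots> \<longleftrightarrow> \<bar>x / \<sigma> j + y\<bar> \<le> sqrt (s / ((\<kappa> j)\<^sup>2 * (\<sigma> j)\<^sup>2))"
      by (metis real_sqrt_abs real_sqrt_le_iff)
    finally show ?thesis .
  qed
  then have "coord j x s
      = prob {\<omega> \<in> space M. \<bar>x / \<sigma> j + \<xi> j \<omega>\<bar> \<le> sqrt (s / ((\<kappa> j)\<^sup>2 * (\<sigma> j)\<^sup>2))}"
    by (simp add: coord_def)
  also have "\<dots> = window (x / \<sigma> j) (sqrt (s / ((\<kappa> j)\<^sup>2 * (\<sigma> j)\<^sup>2)))"
    unfolding window_def by (rule noise_law) measurable
  finally show ?thesis .
qed

lemma coord_negative: "s < 0 \<Longrightarrow> coord j x s = 0"
proof -
  assume "s < 0"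
  then have "\<not> (\<kappa> j)\<^sup>2 * (x + \<sigma> j * \<xi> j \<omega>)\<^sup>2 \<le> s" for \<omega>
    by (simp add: not_le less_le_trans[OF _ mult_nonneg_nonneg])
  then show ?thesis by (simp add: coord_def)
qed

lemma coord_antimono:
  assumes "\<bar>x\<bar> \<le> \<bar>y\<bar>"
  shows "coord j y s \<le> coord j x s"
proof (cases "0 \<le> s")
  case True
  have "\<bar>x / \<sigma> j\<bar> \<le> \<bar>y / \<sigma> j\<bar>" using assms sigma_pos[of j] by (simp add: abs_divide divide_right_mono)
  with True show ?thesis by (simp add: coord_eq_window window_antimono_abs)
qed (simp add: coord_negative)

lemma level_eq_coord:
  assumes "weighted_l2 a"
  shows "integrable M (\<lambda>\<omega>. coord j (a j) (t - rest j a \<omega>))"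
    and "level a t = expectation (\<lambda>\<omega>. coord j (a j) (t - rest j a \<omega>))"
proof -
  have P: "Measurable.pred borel (\<lambda>q :: real. q \<le> t)" by measurable
  note c = condition_on_rest[OF assms P, of j]
  show "level a t = expectation (\<lambda>\<omega>. coord j (a j) (t - rest j a \<omega>))"
    using c(2) by (simp add: level_def coord_def le_diff_eq)
  have "(\<lambda>\<omega>. coord j (a j) (t - rest j a \<omega>)) \<in> borel_measurable M"
    using c(1) by (simp add: coord_def le_diff_eq)
  then show "integrable M (\<lambda>\<omega>. coord j (a j) (t - rest j a \<omega>))"
    by (intro integrable_const_bound[where B = 1]) (auto simp: coord_def)
qed

lemma rest_cong: "(\<And>i. i \<noteq> j \<Longrightarrow> a i = b i) \<Longrightarrow> rest j a = rest j b"
  unfolding rest_def[abs_def] by (intro ext arg_cong[where f = suminf]) auto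

lemma level_antimono_coordinate:
  assumes a: "weighted_l2 a" and x: "\<bar>x\<bar> \<le> \<bar>a j\<bar>"
  shows "level a t \<le> level (a(j := x)) t"
proof -
  have b: "weighted_l2 (a(j := x))" using x by (intro weighted_l2_mono[OF a]) auto
  have "rest j (a(j := x)) = rest j a" by (rule rest_cong) auto
  then show ?thesis
    unfolding level_eq_coord(2)[OF a, of t j] level_eq_coord(2)[OF b, of t j]
    using level_eq_coord(1)[OF a, of j t] level_eq_coord(1)[OF b, of j t] x
    by (auto intro!: integral_mono coord_antimono)
qed

text \<open>
  Anderson's inequality for the quadratic form, obtained by shrinking one coordinate of the shift
  after the other.
\<close>

lemma level_antimono:
  assumes "finite J" "weighted_l2 a" "\<And>j. \<bar>b j\<bar> \<le> \<bar>a j\<bar>"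
  shows "level a t \<le> level (\<lambda>j. if j \<in> J then b j else a j) t"
  using assms(1)
proof (induction J)
  case empty
  show ?case by simp
next
  case (insert k J)
  let ?c = "\<lambda>j. if j \<in> J then b j else a j"
  have "weighted_l2 ?c" by (rule weighted_l2_mono[OF assms(2)]) (simp add: assms(3))
  then have "level ?c t \<le> level (?c(k := b k)) t"
    using insert assms(3) by (intro level_antimono_coordinate) auto
  also have "?c(k := b k) = (\<lambda>j. if j \<in> insert k J then b j else a j)" by auto
  finally show ?case using insert by simp
qed

text \<open>
  The summand with index \<open>0\<close> alone already spreads \<open>Q a\<close> out, whatever the value of the
  remaining sum. Its weight \<open>(\<kappa> 0)\<^sup>2 * (\<sigma> 0)\<^sup>2\<close> does not depend on the alternative.
\<close>

lemma concentration:
  assumes "weighted_l2 a" "a 0 = 0" "0 \<le> \<epsilon>"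
  shows "prob {\<omega> \<in> space M. t - \<epsilon> < Q a \<omega> \<and> Q a \<omega> \<le> t} \<le> 2 * sqrt (\<epsilon> / ((\<kappa> 0)\<^sup>2 * (\<sigma> 0)\<^sup>2))"
proof -
  define b where "b = (\<kappa> 0)\<^sup>2 * (\<sigma> 0)\<^sup>2"
  have b: "0 < b" unfolding b_def by (rule weight_pos)
  have P: "Measurable.pred borel (\<lambda>q :: real. t - \<epsilon> < q \<and> q \<le> t)" by measurable
  have "prob {\<omega>' \<in> space M. t - \<epsilon> < (\<kappa> 0)\<^sup>2 * (a 0 + \<sigma> 0 * \<xi> 0 \<omega>')\<^sup>2 + r \<and>
      (\<kappa> 0)\<^sup>2 * (a 0 + \<sigma> 0 * \<xi> 0 \<omega>')\<^sup>2 + r \<le> t} \<le> 2 * sqrt (\<epsilon> / b)" for r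
  proof -
    have "t - \<epsilon> < (\<kappa> 0)\<^sup>2 * (a 0 + \<sigma> 0 * y)\<^sup>2 + r \<and> (\<kappa> 0)\<^sup>2 * (a 0 + \<sigma> 0 * y)\<^sup>2 + r \<le> t \<longleftrightarrow>
        (t - r) / b - \<epsilon> / b < y\<^sup>2 \<and> y\<^sup>2 \<le> (t - r) / b" for y
    proof -
      have "(\<kappa> 0)\<^sup>2 * (a 0 + \<sigma> 0 * y)\<^sup>2 = b * y\<^sup>2"
        by (simp add: b_def assms(2) power_mult_distrib)
      then show ?thesis
        using b by (simp add: diff_divide_distrib[symmetric] pos_divide_less_eq pos_le_divide_eq algebra_simps)
    qed
    moreover have "prob {\<omega>' \<in> space M. (t - r) / b - \<epsilon> / b < (\<xi> 0 \<omega>')\<^sup>2 \<and> (\<xi> 0 \<omega>')\<^sup>2 \<le> (t - r) / b}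
        = measure std_normal {y. (t - r) / b - \<epsilon> / b < y\<^sup>2 \<and> y\<^sup>2 \<le> (t - r) / b}"
      by (rule noise_law) measurable
    ultimately show ?thesis
      using std_normal_square_concentration[of "\<epsilon> / b" "(t - r) / b"] assms(3) b by simp
  qed
  moreover note c = condition_on_rest[OF assms(1) P, of 0]
  ultimately have "expectation (\<lambda>\<omega>. prob {\<omega>' \<in> space M.
      t - \<epsilon> < (\<kappa> 0)\<^sup>2 * (a 0 + \<sigma> 0 * \<xi> 0 \<omega>')\<^sup>2 + rest 0 a \<omega> \<and>
      (\<kappa> 0)\<^sup>2 * (a 0 + \<sigma> 0 * \<xi> 0 \<omega>')\<^sup>2 + rest 0 a \<omega> \<le> t}) \<le> expectation (\<lambda>_. 2 * sqrt (\<epsilon> / b))"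
    by (intro integral_mono[OF integrable_const_bound[where B = 1] integrable_const]) auto
  then show ?thesis using c(2) by (simp add: b_def prob_space)
qed

lemma weighted_l2_zero: "weighted_l2 (\<lambda>_. 0)"
  by (rule weighted_l2_finite[of "{}"]) auto

lemma weighted_l2_single: "weighted_l2 (\<lambda>i. if i = j then s else 0)"
  by (rule weighted_l2_finite[of "{j}"]) auto

text \<open>
  Stepping back from \<open>t\<close> by a fixed amount \<open>\<epsilon>\<close> keeps half of the probability. This is what
  keeps the widths to which the lemma \<open>window_gap\<close> is applied away from \<open>0\<close>.
\<close>

lemma null_level_backwards:
  assumes "0 < p"
  obtains \<epsilon> where "0 < \<epsilon>" "\<And>t. p \<le> level (\<lambda>_. 0) t \<Longrightarrow> p / 2 \<le> level (\<lambda>_. 0) (t - \<epsilon>)"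
proof -
  define b where "b = (\<kappa> 0)\<^sup>2 * (\<sigma> 0)\<^sup>2"
  have b: "0 < b" unfolding b_def by (rule weight_pos)
  \<comment> \<open>Solves \<open>2 * sqrt (\<epsilon> / b) = p / 2\<close>, so that the concentration bound costs half of \<open>p\<close>.\<close>
  define \<epsilon> where "\<epsilon> = b * (p / 4)\<^sup>2"
  have \<epsilon>: "0 < \<epsilon>" "2 * sqrt (\<epsilon> / b) = p / 2" using b assms by (simp_all add: \<epsilon>_def)
  have "p / 2 \<le> level (\<lambda>_. 0) (t - \<epsilon>)" if "p \<le> level (\<lambda>_. 0) t" for t
  proof -
    have "level (\<lambda>_. 0) t \<le> prob ({\<omega> \<in> space M. Q (\<lambda>_. 0) \<omega> \<le> t - \<epsilon>} \<union>
        {\<omega> \<in> space M. t - \<epsilon> < Q (\<lambda>_. 0) \<omega> \<and> Q (\<lambda>_. 0) \<omega> \<le> t})"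
      unfolding level_def by (intro finite_measure_mono) auto
    also have "\<dots> \<le> level (\<lambda>_. 0) (t - \<epsilon>) +
        prob {\<omega> \<in> space M. t - \<epsilon> < Q (\<lambda>_. 0) \<omega> \<and> Q (\<lambda>_. 0) \<omega> \<le> t}"
      unfolding level_def by (intro measure_Un_le) auto
    also have "\<dots> \<le> level (\<lambda>_. 0) (t - \<epsilon>) + p / 2"
      using concentration[OF weighted_l2_zero, of \<epsilon> t] \<epsilon> by (simp add: b_def)
    finally show ?thesis using that by simp
  qed
  with \<epsilon>(1) show thesis by (rule that)
qed

text \<open>
  On the event that \<open>rest j\<close> is at most \<open>t - \<epsilon>\<close>, which has probability at least \<open>p / 2\<close>, the
  \<open>j\<close>-th term may be as large as some number between \<open>\<epsilon>\<close> and \<open>T\<close>, and there the shift \<open>c\<close>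
  costs at least a fixed \<open>\<eta>\<close>. Elsewhere the shift gains nothing. Integration gives the gap \<open>\<eta> * (p / 2)\<close>.
\<close>

lemma single_shift_gap:
  assumes "0 < c" "0 < p"
  obtains \<delta> where "0 < \<delta>" "\<And>t. t \<le> T \<Longrightarrow> p \<le> level (\<lambda>_. 0) t \<Longrightarrow>
    level (\<lambda>i. if i = j then c else 0) t + \<delta> \<le> level (\<lambda>_. 0) t"
proof -
  obtain \<epsilon> where \<epsilon>: "0 < \<epsilon>" "\<And>t. p \<le> level (\<lambda>_. 0) t \<Longrightarrow> p / 2 \<le> level (\<lambda>_. 0) (t - \<epsilon>)"
    by (rule null_level_backwards[OF assms(2)]) (rule that)
  define b where "b = (\<kappa> j)\<^sup>2 * (\<sigma> j)\<^sup>2"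
  have b: "0 < b" unfolding b_def by (rule weight_pos)
  \<comment> \<open>The maximum only keeps the range of widths nonempty when \<open>T < \<epsilon>\<close>.\<close>
  define v where "v = sqrt (max \<epsilon> T / b)"
  have "0 < c / \<sigma> j" "0 < sqrt (\<epsilon> / b)" "sqrt (\<epsilon> / b) \<le> v"
    using assms(1) sigma_pos[of j] b \<epsilon>(1) by (auto simp: v_def divide_right_mono)
  then obtain \<eta> where \<eta>: "0 < \<eta>"
    "\<And>w. sqrt (\<epsilon> / b) \<le> w \<Longrightarrow> w \<le> v \<Longrightarrow> window (c / \<sigma> j) w + \<eta> \<le> window 0 w"
    by (rule window_gap) (rule that)
  let ?z = "\<lambda>_ :: nat. 0 :: real" and ?c = "\<lambda>i. if i = j then c else 0"
  have r: "rest j ?c = rest j ?z" by (rule rest_cong) auto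
  have coord_gap: "coord j c s + \<eta> \<le> coord j 0 s" if "\<epsilon> \<le> s" "s \<le> T" for s
  proof -
    have "0 \<le> s" using that \<epsilon>(1) by simp
    moreover have "sqrt (\<epsilon> / b) \<le> sqrt (s / b)" "sqrt (s / b) \<le> v"
      using that b by (auto simp: v_def divide_right_mono)
    ultimately show ?thesis
      using \<eta>(2)[of "sqrt (s / b)"] by (simp add: coord_eq_window b_def)
  qed
  have "level ?c t + \<eta> * (p / 2) \<le> level ?z t" if "t \<le> T" "p \<le> level ?z t" for t
  proof -
    let ?B = "{\<omega> \<in> space M. rest j ?z \<omega> \<le> t - \<epsilon>}"
    note int = level_eq_coord(1)[OF weighted_l2_single[of j c], of j t, unfolded r]
      level_eq_coord(1)[OF weighted_l2_zero, of j t]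
    have intB: "integrable M (\<lambda>\<omega>. \<eta> * indicator ?B \<omega>)"
      by (intro integrable_mult_right integrable_real_indicator) (auto simp: emeasure_eq_measure)
    have "p / 2 \<le> level ?z (t - \<epsilon>)" using \<epsilon>(2) that(2) by blast
    also have "\<dots> \<le> prob ?B"
      unfolding level_def
    proof (rule finite_measure_mono_AE)
      show "AE \<omega> in M. \<omega> \<in> {\<omega> \<in> space M. Q ?z \<omega> \<le> t - \<epsilon>} \<longrightarrow> \<omega> \<in> ?B"
        using AE_Q_split[OF weighted_l2_zero, of j]
      proof eventually_elim
        case (elim \<omega>)
        then have "rest j ?z \<omega> \<le> Q ?z \<omega>" by simp
        then show ?case by auto
      qed
    qed measurable
    finally have "level ?c t + \<eta> * (p / 2) \<le> level ?c t + \<eta> * prob ?B"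
      using \<eta>(1) by simp
    also have "\<dots> = expectation (\<lambda>\<omega>. coord j c (t - rest j ?z \<omega>) + \<eta> * indicator ?B \<omega>)"
      using level_eq_coord(2)[OF weighted_l2_single[of j c], of t j, unfolded r] int(1) intB
      by (subst Bochner_Integration.integral_add) auto
    also have "\<dots> \<le> expectation (\<lambda>\<omega>. coord j 0 (t - rest j ?z \<omega>))"
    proof (rule integral_mono_AE)
      show "integrable M (\<lambda>\<omega>. coord j c (t - rest j ?z \<omega>) + \<eta> * indicator ?B \<omega>)"
        using int(1) intB by simp
      show "integrable M (\<lambda>\<omega>. coord j 0 (t - rest j ?z \<omega>))" using int(2) by simp
      show "AE \<omega> in M. coord j c (t - rest j ?z \<omega>) + \<eta> * indicator ?B \<omega>
          \<le> coord j 0 (t - rest j ?z \<omega>)"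
        using AE_Q_split[OF weighted_l2_zero, of j]
      proof eventually_elim
        case (elim \<omega>)
        show ?case
        proof (cases "\<omega> \<in> ?B")
          case True
          then show ?thesis using coord_gap[of "t - rest j ?z \<omega>"] elim that(1) by simp
        next
          case False
          then show ?thesis using coord_antimono[of 0 c j] by simp
        qed
      qed
    qed
    also have "\<dots> = level ?z t" using level_eq_coord(2)[OF weighted_l2_zero, of t j] by simp
    finally show ?thesis .
  qed
  moreover have "0 < \<eta> * (p / 2)" using \<eta>(1) assms(2) by simp
  ultimately show thesis by (intro that)
qed

lemma AE_Q_single:
  "AE \<omega> in M. Q (\<lambda>i. if i = j then s else 0) \<omega>
    = Q (\<lambda>_. 0) \<omega> + (\<kappa> j)\<^sup>2 * (s\<^sup>2 + 2 * s * \<sigma> j * \<xi> j \<omega>)"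
  using AE_Q_split[OF weighted_l2_single[of j s], of j] AE_Q_split[OF weighted_l2_zero, of j]
proof eventually_elim
  case (elim \<omega>)
  have "rest j (\<lambda>i. if i = j then s else 0) = rest j (\<lambda>_. 0)" by (rule rest_cong) auto
  with elim show ?case by (simp add: power2_eq_square algebra_simps)
qed

text \<open>
  A shift of size at most \<open>1\<close> in the coordinate \<open>j\<close> changes the quadratic form by
  \<open>(\<kappa> j)\<^sup>2 * (s\<^sup>2 + 2 * s * \<sigma> j * \<xi> j)\<close>. This is at most \<open>\<bar>\<kappa> j\<bar>\<close> outside an event that the second moment
  method controls, and a change by \<open>\<bar>\<kappa> j\<bar>\<close> is invisible by concentration. Both error terms
  vanish with \<open>\<kappa> j\<close>, uniformly in the threshold \<open>t\<close>.
\<close>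

lemma single_shift_bound:
  assumes "\<bar>s\<bar> \<le> 1"
  shows "level (\<lambda>_. 0) t \<le> level (\<lambda>i. if i = j then s else 0) t
    + 2 * sqrt (\<bar>\<kappa> j\<bar> / ((\<kappa> 0)\<^sup>2 * (\<sigma> 0)\<^sup>2)) + (\<kappa> j)\<^sup>2 * (1 + 4 * (\<sigma> j)\<^sup>2)"
proof -
  let ?z = "\<lambda>_ :: nat. 0 :: real" and ?s = "\<lambda>i. if i = j then s else 0"
  \<comment> \<open>The second moment of the change is of order \<open>(\<kappa> j) ^ 4\<close>; with \<open>\<epsilon> = \<bar>\<kappa> j\<bar>\<close> its quotient by
    \<open>\<epsilon>\<^sup>2\<close> still tends to \<open>0\<close>.\<close>
  define \<epsilon> where "\<epsilon> = \<bar>\<kappa> j\<bar>"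
  have \<epsilon>: "0 < \<epsilon>" using kappa_nonzero by (simp add: \<epsilon>_def)
  define D where "D \<omega> = (\<kappa> j)\<^sup>2 * (s\<^sup>2 + 2 * s * \<sigma> j * \<xi> j \<omega>)" for \<omega>
  have [measurable]: "D \<in> borel_measurable M" unfolding D_def[abs_def] by measurable
  have D_sq: "(\<lambda>\<omega>. (D \<omega>)\<^sup>2) = (\<lambda>\<omega>. (\<kappa> j) ^ 4 * s ^ 4
      + (\<kappa> j) ^ 4 * (4 * s ^ 3 * \<sigma> j) * \<xi> j \<omega> + (\<kappa> j) ^ 4 * (4 * s\<^sup>2 * (\<sigma> j)\<^sup>2) * (\<xi> j \<omega>)\<^sup>2)"
    by (auto simp: D_def power2_eq_square power3_eq_cube power4_eq_xxxx algebra_simps)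
  have int: "integrable M (\<lambda>\<omega>. (D \<omega>)\<^sup>2)"
    unfolding D_sq by (intro Bochner_Integration.integrable_add integrable_mult_right noise_moments) simp
  have "expectation (\<lambda>\<omega>. (D \<omega>)\<^sup>2) = (\<kappa> j) ^ 4 * (s ^ 4 + 4 * s\<^sup>2 * (\<sigma> j)\<^sup>2)"
    unfolding D_sq by (simp add: noise_moments prob_space algebra_simps)
  also have "\<dots> \<le> (\<kappa> j) ^ 4 * (1 + 4 * 1 * (\<sigma> j)\<^sup>2)"
  proof -
    have "s\<^sup>2 \<le> 1" using assms by (simp add: abs_square_le_1)
    moreover from this have "s ^ 4 \<le> 1" using power_le_one[of "s\<^sup>2" 2] by simp
    ultimately show ?thesis by (intro mult_left_mono add_mono mult_right_mono) auto
  qed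
  finally have D_sq_le: "expectation (\<lambda>\<omega>. (D \<omega>)\<^sup>2) \<le> (\<kappa> j) ^ 4 * (1 + 4 * (\<sigma> j)\<^sup>2)" by simp
  have "prob {\<omega> \<in> space M. \<epsilon> \<le> \<bar>D \<omega>\<bar>} \<le> expectation (\<lambda>\<omega>. (D \<omega>)\<^sup>2) / \<epsilon>\<^sup>2"
    using int \<epsilon> by (intro second_moment_method) auto
  also have "\<dots> \<le> (\<kappa> j) ^ 4 * (1 + 4 * (\<sigma> j)\<^sup>2) / \<epsilon>\<^sup>2"
    using D_sq_le by (intro divide_right_mono) auto
  also have "\<dots> = (\<kappa> j)\<^sup>2 * (1 + 4 * (\<sigma> j)\<^sup>2)"
    using kappa_nonzero[of j] by (simp add: \<epsilon>_def power2_eq_square power4_eq_xxxx)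
  finally have tail: "prob {\<omega> \<in> space M. \<epsilon> \<le> \<bar>D \<omega>\<bar>} \<le> (\<kappa> j)\<^sup>2 * (1 + 4 * (\<sigma> j)\<^sup>2)" .
  let ?A = "{\<omega> \<in> space M. Q ?s \<omega> \<le> t}"
    and ?B = "{\<omega> \<in> space M. t - \<epsilon> < Q ?z \<omega> \<and> Q ?z \<omega> \<le> t}"
    and ?C = "{\<omega> \<in> space M. \<epsilon> \<le> \<bar>D \<omega>\<bar>}"
  have "level ?z t \<le> prob ((?A \<union> ?B) \<union> ?C)"
    unfolding level_def
  proof (rule finite_measure_mono_AE)
    show "AE \<omega> in M. \<omega> \<in> {\<omega> \<in> space M. Q ?z \<omega> \<le> t} \<longrightarrow> \<omega> \<in> (?A \<union> ?B) \<union> ?C"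
      using AE_Q_single[of j s] by eventually_elim (auto simp: D_def[symmetric])
  qed measurable
  also have "\<dots> \<le> prob (?A \<union> ?B) + prob ?C" by (intro measure_Un_le) measurable
  also have "\<dots> \<le> (prob ?A + prob ?B) + prob ?C" by (intro add_right_mono measure_Un_le) measurable
  also have "\<dots> \<le> (level ?s t + 2 * sqrt (\<epsilon> / ((\<kappa> 0)\<^sup>2 * (\<sigma> 0)\<^sup>2))) + (\<kappa> j)\<^sup>2 * (1 + 4 * (\<sigma> j)\<^sup>2)"
    using \<epsilon> by (intro add_mono tail concentration weighted_l2_zero) (auto simp: level_def)
  finally show ?thesis by (simp add: \<epsilon>_def)
qed

section \<open>Error probabilities of tests generated by the statistic\<close>

lemma level_mono: "s \<le> t \<Longrightarrow> level a s \<le> level a t"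
  unfolding level_def by (intro finite_measure_mono) auto

lemma null_level_near_1:
  assumes "q < 1"
  shows "\<exists>T. q \<le> level (\<lambda>_. 0) T"
proof -
  interpret Q: real_distribution "distr M borel (Q (\<lambda>_. 0))" by (rule real_distribution_distr) simp
  have "cdf (distr M borel (Q (\<lambda>_. 0))) = level (\<lambda>_. 0)"
    unfolding cdf_def level_def fun_eq_iff
    by (subst measure_distr) (auto intro!: arg_cong[where f = prob])
  then have "(level (\<lambda>_. 0) \<longlongrightarrow> 1) at_top"
    using Q.cdf_lim_at_top_prob by simp
  then have "\<forall>\<^sub>F t in at_top. q < level (\<lambda>_. 0) t"
    using assms by (rule order_tendstoD)
  then obtain T where "q < level (\<lambda>_. 0) T"
    by (auto simp: eventually_at_top_linorder)
  then show ?thesis by (intro exI[of _ T]) simp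
qed

lemma AE_T_stat_observation:
  assumes n: "1 \<le> n" and a: "weighted_l2 (\<lambda>j. sqrt n * \<theta> j)"
  shows "AE \<omega> in M. T_stat \<kappa> (observation \<sigma> \<xi> n \<theta> \<omega>) = Q (\<lambda>j. sqrt n * \<theta> j) \<omega> / n"
  using AE_summable_Q[OF a]
proof eventually_elim
  case (elim \<omega>)
  have root: "real n powr (-1/2) = 1 / sqrt n"
    by (simp add: powr_minus_divide powr_half_sqrt)
  have "(\<kappa> j)\<^sup>2 * (observation \<sigma> \<xi> n \<theta> \<omega> j)\<^sup>2 =
      (\<kappa> j)\<^sup>2 * (sqrt n * \<theta> j + \<sigma> j * \<xi> j \<omega>)\<^sup>2 / n" for j
  proof -
    have "observation \<sigma> \<xi> n \<theta> \<omega> j = (sqrt n * \<theta> j + \<sigma> j * \<xi> j \<omega>) / sqrt n"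
      unfolding observation_def root using n by (simp add: field_simps)
    then show ?thesis by (simp add: power_divide)
  qed
  then show ?case
    unfolding T_stat_def Q_def by (simp add: suminf_divide[OF elim])
qed

lemma T_stat_measurable [measurable]:
  "(\<lambda>\<omega>. T_stat \<kappa> (observation \<sigma> \<xi> n \<theta> \<omega>)) \<in> borel_measurable M"
  unfolding T_stat_def observation_def by measurable

lemma prob_T_stat_le:
  assumes n: "1 \<le> n" and a: "weighted_l2 (\<lambda>j. sqrt n * \<theta> j)"
  shows "prob {\<omega> \<in> space M. T_stat \<kappa> (observation \<sigma> \<xi> n \<theta> \<omega>) \<le> t}
    = level (\<lambda>j. sqrt n * \<theta> j) (n * t)"
  unfolding level_def
proof (rule finite_measure_eq_AE)
  show "AE \<omega> in M. \<omega> \<in> {\<omega> \<in> space M. T_stat \<kappa> (observation \<sigma> \<xi> n \<theta> \<omega>) \<le> t} \<longleftrightarrow>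
      \<omega> \<in> {\<omega> \<in> space M. Q (\<lambda>j. sqrt n * \<theta> j) \<omega> \<le> n * t}"
    using AE_T_stat_observation[OF n a]
    by eventually_elim (use n in \<open>auto simp: pos_divide_le_eq mult.commute\<close>)
qed measurable

lemma type_I_error_eq:
  assumes n: "1 \<le> n" and K: "\<And>y. K y \<longleftrightarrow> T_stat \<kappa> y > t"
  shows "type_I_error M \<xi> \<sigma> n K = 1 - level (\<lambda>_. 0) (n * t)"
proof -
  have "type_I_error M \<xi> \<sigma> n K
      = 1 - prob {\<omega> \<in> space M. \<not> T_stat \<kappa> (observation \<sigma> \<xi> n (\<lambda>_. 0) \<omega>) > t}"
    unfolding type_I_error_def K by (subst prob_neg) auto
  then show ?thesis
    using prob_T_stat_le[OF n, of "\<lambda>_. 0" t] by (simp add: not_less weighted_l2_zero)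
qed

lemma type_II_error_eq:
  assumes n: "1 \<le> n" and K: "\<And>y. K y \<longleftrightarrow> T_stat \<kappa> y > t"
    and a: "weighted_l2 (\<lambda>j. sqrt n * coeffs_of \<phi> f j)"
  shows "type_II_error M \<xi> \<sigma> \<phi> n K f = level (\<lambda>j. sqrt n * coeffs_of \<phi> f j) (n * t)"
  using prob_T_stat_le[OF n a, of t] by (simp add: type_II_error_def K not_less)

section \<open>Consistency on finite-dimensional balls\<close>

text \<open>
  A shift supported on \<open>{..<l}\<close> with norm above \<open>c\<close> has a coordinate of size at least
  \<open>c / sqrt l\<close>. Shrinking it to that value and all other coordinates to \<open>0\<close> leaves only the \<open>l\<close>
  shifts along the axes, each with its own gap. The bounds \<open>p\<close> and \<open>q\<close> on the null probability
  confine the threshold to a range on which these gaps are uniform.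
\<close>

lemma finite_support_gap:
  assumes "1 \<le> l" "0 < c" "0 < p" "q < 1"
  obtains \<delta> where "0 < \<delta>"
    "\<And>a t. \<lbrakk>\<And>j. l \<le> j \<Longrightarrow> a j = 0; c\<^sup>2 < (\<Sum>j<l. (a j)\<^sup>2); p \<le> level (\<lambda>_. 0) t; level (\<lambda>_. 0) t < q\<rbrakk>
      \<Longrightarrow> level a t + \<delta> \<le> level (\<lambda>_. 0) t"
proof -
  define d where "d = c / sqrt l"
  have d: "0 < d" and d2: "d\<^sup>2 = c\<^sup>2 / l" using assms by (simp_all add: d_def power_divide)
  obtain T where T: "q \<le> level (\<lambda>_. 0) T" using null_level_near_1[OF assms(4)] by blast
  have "\<exists>\<delta>>0. \<forall>t. t \<le> T \<longrightarrow> p \<le> level (\<lambda>_. 0) t \<longrightarrow>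
      level (\<lambda>i. if i = j then d else 0) t + \<delta> \<le> level (\<lambda>_. 0) t" for j
    by (rule single_shift_gap[OF d assms(3), of T j]) blast
  then obtain \<delta> where \<delta>: "\<And>j. 0 < \<delta> j" "\<And>j t. t \<le> T \<Longrightarrow> p \<le> level (\<lambda>_. 0) t \<Longrightarrow>
      level (\<lambda>i. if i = j then d else 0) t + \<delta> j \<le> level (\<lambda>_. 0) t"
    by metis
  define \<delta>0 where "\<delta>0 = Min (\<delta> ` {..<l})"
  have ne: "\<delta> ` {..<l} \<noteq> {}" using assms(1) by (auto simp: lessThan_empty_iff)
  then have "0 < \<delta>0" using \<delta>(1) by (simp add: \<delta>0_def)
  moreover have "level a t + \<delta>0 \<le> level (\<lambda>_. 0) t"
    if supp: "\<And>j. l \<le> j \<Longrightarrow> a j = 0" and norm: "c\<^sup>2 < (\<Sum>j<l. (a j)\<^sup>2)"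
      and t: "p \<le> level (\<lambda>_. 0) t" "level (\<lambda>_. 0) t < q" for a t
  proof -
    have "t \<le> T" using t(2) T level_mono[of T t "\<lambda>_. 0"] by linarith
    have "\<exists>j<l. d\<^sup>2 \<le> (a j)\<^sup>2"
    proof (rule ccontr)
      assume "\<not> ?thesis"
      then have "(\<Sum>j<l. (a j)\<^sup>2) \<le> (\<Sum>j<l. d\<^sup>2)" by (intro sum_mono) (auto simp: not_le less_imp_le)
      also have "\<dots> = c\<^sup>2" using assms(1) by (simp add: d2)
      finally show False using norm by simp
    qed
    then obtain j where j: "j < l" "d\<^sup>2 \<le> (a j)\<^sup>2" by blast
    let ?b = "\<lambda>i. if i = j then d else 0"
    have "\<bar>?b i\<bar> \<le> \<bar>a i\<bar>" for i using j(2) by (auto simp: abs_le_square_iff)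
    then have "level a t \<le> level (\<lambda>i. if i \<in> {..<l} then ?b i else a i) t"
      using supp by (intro level_antimono weighted_l2_finite[of "{..<l}"]) (auto simp: not_less)
    also have "(\<lambda>i. if i \<in> {..<l} then ?b i else a i) = ?b" using supp j(1) by (auto simp: not_less)
    finally have "level a t + \<delta>0 \<le> level ?b t + \<delta> j"
      using j(1) by (intro add_mono) (auto simp: \<delta>0_def intro!: Min_le)
    with \<delta>(2)[OF \<open>t \<le> T\<close> t(1), of j] show ?thesis by simp
  qed
  ultimately show thesis by (rule that)
qed

text \<open>
  The lower rate \<open>c\<close> keeps the norm of the rescaled shift \<open>sqrt (m i) * \<theta>\<close> above \<open>c\<close>, and the
  prescribed type I error makes the null probability of acceptance converge to \<open>1 - \<alpha>\<close>, which
  lies strictly between \<open>p = (1 - \<alpha>) / 2\<close> and \<open>q = 1 - \<alpha> / 2\<close>.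
\<close>

lemma consistent_finite_dimensional:
  assumes basis: "L2_orthonormal_basis \<phi>" and "1 \<le> l" "0 < c" and m: "\<And>i. 1 \<le> m i"
    and F: "\<And>i. F i \<in> (\<lambda>g x. \<gamma> * g x) ` U_set \<phi> l P0"
    and rate: "norm_rate_between (1/2) c C m F"
  shows "consistent_along M \<xi> \<sigma> \<phi> (T_stat \<kappa>) m F"
  unfolding consistent_along_def
proof (intro ballI allI impI)
  fix \<alpha> :: real and K :: "nat \<Rightarrow> test"
  assume \<alpha>: "\<alpha> \<in> {0<..<1}" and gen: "\<forall>n. generated_by (T_stat \<kappa>) (K n)"
    and "\<exists>\<epsilon>. \<epsilon> \<longlonglongrightarrow> 0 \<and> (\<forall>i. type_I_error M \<xi> \<sigma> (m i) (K (m i)) = \<alpha> * (1 + \<epsilon> i))"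
  then obtain \<epsilon> where \<epsilon>: "\<epsilon> \<longlonglongrightarrow> 0"
    "\<And>i. type_I_error M \<xi> \<sigma> (m i) (K (m i)) = \<alpha> * (1 + \<epsilon> i)" by blast
  obtain \<tau> where \<tau>: "\<And>n y. K n y \<longleftrightarrow> T_stat \<kappa> y > \<tau> n"
    using gen unfolding generated_by_def by metis
  define t where "t i = real (m i) * \<tau> (m i)" for i
  define a where "a i j = sqrt (m i) * coeffs_of \<phi> (F i) j" for i j
  have null: "level (\<lambda>_. 0) (t i) = 1 - \<alpha> * (1 + \<epsilon> i)" for i
    using type_I_error_eq[OF m \<tau>, of i] \<epsilon>(2)[of i] by (simp add: t_def)
  have shift: "a i j = 0" "c\<^sup>2 < (\<Sum>j<l. (a i j)\<^sup>2)" if "l \<le> j" for i j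
  proof -
    obtain g \<theta> where g: "g \<in> L2" "F i = (\<lambda>x. \<gamma> * g x)"
      "AE x in unit_measure. g x = (\<Sum>j<l. \<theta> j * \<phi> j x)"
      using F[of i] by (auto simp: U_set_def)
    have "F i \<in> L2" using g by (simp add: L2_scale)
    moreover have "AE x in unit_measure. F i x = (\<Sum>j<l. \<gamma> * \<theta> j * \<phi> j x)"
      using g(3) by eventually_elim (simp add: g(2) sum_distrib_left mult.assoc)
    ultimately have coeff: "\<And>j. coeffs_of \<phi> (F i) j = (if j < l then \<gamma> * \<theta> j else 0)"
      and norm: "(L2_norm (F i))\<^sup>2 = (\<Sum>j<l. (\<gamma> * \<theta> j)\<^sup>2)"
      by (rule coeffs_of_finite_expansion[OF basis])+
    show "a i j = 0" using that by (simp add: a_def coeff)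
    have "c / sqrt (m i) < L2_norm (F i)"
      using rate by (simp add: norm_rate_between_def powr_minus_divide powr_half_sqrt)
    then have "c < sqrt (m i) * L2_norm (F i)"
      using m[of i] by (simp add: pos_divide_less_eq mult.commute)
    then have "c\<^sup>2 < (sqrt (m i) * L2_norm (F i))\<^sup>2"
      using \<open>0 < c\<close> by (intro power_strict_mono) auto
    then show "c\<^sup>2 < (\<Sum>j<l. (a i j)\<^sup>2)"
      by (simp add: power_mult_distrib norm sum_distrib_left a_def coeff)
  qed
  have power: "type_II_error M \<xi> \<sigma> \<phi> (m i) (K (m i)) (F i) = level (a i) (t i)" for i
  proof -
    have "weighted_l2 (a i)" by (rule weighted_l2_finite[of "{..<l}"]) (auto intro: shift)
    then show ?thesis
      using type_II_error_eq[OF m \<tau>, of i \<phi> "F i"] by (simp add: a_def[abs_def] t_def)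
  qed
  have lim: "(\<lambda>i. 1 - \<alpha> * (1 + \<epsilon> i)) \<longlonglongrightarrow> 1 - \<alpha> * (1 + 0)"
    by (intro tendsto_intros \<epsilon>(1))
  obtain \<delta> where \<delta>: "0 < \<delta>" "\<And>a t. \<lbrakk>\<And>j. l \<le> j \<Longrightarrow> a j = 0; c\<^sup>2 < (\<Sum>j<l. (a j)\<^sup>2);
      (1 - \<alpha>) / 2 \<le> level (\<lambda>_. 0) t; level (\<lambda>_. 0) t < 1 - \<alpha> / 2\<rbrakk>
      \<Longrightarrow> level a t + \<delta> \<le> level (\<lambda>_. 0) t"
  proof (rule finite_support_gap[of l c "(1 - \<alpha>) / 2" "1 - \<alpha> / 2"])
  qed (use \<alpha> \<open>1 \<le> l\<close> \<open>0 < c\<close> in auto)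
  have "\<forall>\<^sub>F i in sequentially. (1 - \<alpha>) / 2 < 1 - \<alpha> * (1 + \<epsilon> i)"
    using \<alpha> by (intro order_tendstoD[OF lim]) (simp add: field_simps)
  moreover have "\<forall>\<^sub>F i in sequentially. 1 - \<alpha> * (1 + \<epsilon> i) < 1 - \<alpha> / 2"
    using \<alpha> by (intro order_tendstoD[OF lim]) simp
  ultimately have "\<forall>\<^sub>F i in sequentially. type_II_error M \<xi> \<sigma> \<phi> (m i) (K (m i)) (F i)
      \<le> 1 - \<alpha> * (1 + \<epsilon> i) - \<delta>"
  proof eventually_elim
    case (elim i)
    have "level (a i) (t i) + \<delta> \<le> level (\<lambda>_. 0) (t i)"
      using elim by (intro \<delta>(2)) (auto simp: null intro: shift)
    then show ?case by (simp add: power null)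
  qed
  then have "limsup (\<lambda>i. ereal (type_II_error M \<xi> \<sigma> \<phi> (m i) (K (m i)) (F i)))
      \<le> limsup (\<lambda>i. ereal (1 - \<alpha> * (1 + \<epsilon> i) - \<delta>))"
    by (intro Limsup_mono) auto
  also have "\<dots> = ereal (1 - \<alpha> * (1 + 0) - \<delta>)"
    by (intro lim_imp_Limsup tendsto_ereal tendsto_diff[OF lim tendsto_const]) simp
  also have "\<dots> < ereal (1 - \<alpha>)" using \<delta>(1) by simp
  finally show "limsup (\<lambda>i. ereal (type_II_error M \<xi> \<sigma> \<phi> (m i) (K (m i)) (F i))) < ereal (1 - \<alpha>)" .
qed

section \<open>Inconsistency along high-frequency axes\<close>

text \<open>
  After rescaling, the \<open>i\<close>-th alternative is the unit shift of the coordinate \<open>k i\<close>. Since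
  \<open>\<kappa> (k i)\<close> tends to \<open>0\<close>, the acceptance probabilities under the hypothesis and under the
  alternative merge, uniformly over all thresholds.
\<close>

lemma inconsistent_axes:
  assumes basis: "L2_orthonormal_basis \<phi>" and m: "\<And>i. 1 \<le> m i" and k: "\<And>i. i \<le> k i"
    and F: "\<And>i. F i = (\<lambda>x. 1 / sqrt (m i) * \<phi> (k i) x)"
  shows "inconsistent_along M \<xi> \<sigma> \<phi> (T_stat \<kappa>) m F"
  unfolding inconsistent_along_def
proof (intro allI impI)
  fix K :: "nat \<Rightarrow> test"
  assume gen: "\<forall>n. generated_by (T_stat \<kappa>) (K n)"
  obtain \<tau> where \<tau>: "\<And>n y. K n y \<longleftrightarrow> T_stat \<kappa> y > \<tau> n"
    using gen unfolding generated_by_def by metis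
  define t where "t i = real (m i) * \<tau> (m i)" for i
  obtain C where C: "\<And>j. 0 < \<sigma> j" "\<And>j. \<sigma> j < C" using D2 by (auto simp: D2_def)
  define err where "err j = 2 * sqrt (\<bar>\<kappa> j\<bar> / ((\<kappa> 0)\<^sup>2 * (\<sigma> 0)\<^sup>2)) + (\<kappa> j)\<^sup>2 * (1 + 4 * C\<^sup>2)" for j
  have "(\<lambda>j. (\<kappa> j)\<^sup>2) \<longlonglongrightarrow> 0" by (rule summable_LIMSEQ_zero[OF kappa_summable])
  moreover from tendsto_real_sqrt[OF this] have "(\<lambda>j. \<bar>\<kappa> j\<bar>) \<longlonglongrightarrow> 0" by simp
  ultimately have "err \<longlonglongrightarrow> 2 * sqrt (0 / ((\<kappa> 0)\<^sup>2 * (\<sigma> 0)\<^sup>2)) + 0 * (1 + 4 * C\<^sup>2)"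
    unfolding err_def[abs_def] by (intro tendsto_intros) (use weight_pos[of 0] in auto)
  moreover have "filterlim k at_top sequentially"
    by (rule filterlim_at_top_mono[OF filterlim_ident]) (auto simp: k)
  ultimately have err: "(\<lambda>i. err (k i)) \<longlonglongrightarrow> 0"
    by (auto intro: filterlim_compose)
  have shift: "(\<lambda>j. sqrt (m i) * coeffs_of \<phi> (F i) j) = (\<lambda>j. if j = k i then 1 else 0)" for i
    unfolding F coeffs_of_scaled_basis(1)[OF basis] using m[of i] by auto
  have "1 - err (k i) \<le> type_I_error M \<xi> \<sigma> (m i) (K (m i)) + type_II_error M \<xi> \<sigma> \<phi> (m i) (K (m i)) (F i)"
    for i
  proof -
    have "type_I_error M \<xi> \<sigma> (m i) (K (m i)) = 1 - level (\<lambda>_. 0) (t i)"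
      using type_I_error_eq[OF m \<tau>] by (simp add: t_def)
    moreover have "type_II_error M \<xi> \<sigma> \<phi> (m i) (K (m i)) (F i) = level (\<lambda>j. if j = k i then 1 else 0) (t i)"
      using type_II_error_eq[OF m \<tau>, of i \<phi> "F i", unfolded shift] by (simp add: t_def weighted_l2_single)
    moreover have "(\<sigma> (k i))\<^sup>2 \<le> C\<^sup>2" using C[of "k i"] by (intro power_mono) auto
    then have "(\<kappa> (k i))\<^sup>2 * (1 + 4 * (\<sigma> (k i))\<^sup>2) \<le> (\<kappa> (k i))\<^sup>2 * (1 + 4 * C\<^sup>2)"
      by (intro mult_left_mono) auto
    ultimately show ?thesis
      using single_shift_bound[of 1 "t i" "k i"] by (simp add: err_def)
  qed
  then have "liminf (\<lambda>i. ereal (1 - err (k i))) \<le> liminf (\<lambda>i. ereal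
      (type_I_error M \<xi> \<sigma> (m i) (K (m i)) + type_II_error M \<xi> \<sigma> \<phi> (m i) (K (m i)) (F i)))"
    by (intro Liminf_mono always_eventually) auto
  moreover have "liminf (\<lambda>i. ereal (1 - err (k i))) = ereal (1 - 0)"
    by (intro lim_imp_Liminf tendsto_ereal tendsto_diff tendsto_const err) simp
  ultimately show "1 \<le> liminf (\<lambda>i. ereal
      (type_I_error M \<xi> \<sigma> (m i) (K (m i)) + type_II_error M \<xi> \<sigma> \<phi> (m i) (K (m i)) (F i)))"
    by (simp add: one_ereal_def)
qed

end

lemma strict_mono_above:
  fixes N :: "nat \<Rightarrow> nat"
  obtains m :: "nat \<Rightarrow> nat" where "strict_mono m" "\<And>i. 1 \<le> m i" "\<And>i. N i \<le> m i"
proof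
  let ?m = "\<lambda>i. \<Sum>k\<le>i. N k + 1"
  show "strict_mono ?m" by (rule strict_mono_Suc_iff[THEN iffD2]) simp
  have "N i + 1 \<le> ?m i" for i by (rule member_le_sum) auto
  from add_leD1[OF this] add_leD2[OF this] show "N i \<le> ?m i" "1 \<le> ?m i" for i .
qed

text \<open>
  There are nonzero coefficients \<open>\<theta> (k i)\<close> of arbitrarily large index. The sample sizes \<open>m i\<close>
  are taken so large that \<open>1 / sqrt (m i) \<le> \<bar>\<theta> (k i)\<bar>\<close>, so that the axis segment inside \<open>V\<close>
  reaches that far.
\<close>

lemma inconsistent_subsequence_exists:
  assumes basis: "L2_orthonormal_basis \<phi>" and f: "f \<in> L2" "f \<notin> Xi_set \<phi>"
    and V: "L2_convex V" "ortho_symmetric \<phi> V" "f \<in> V"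
  obtains m k :: "nat \<Rightarrow> nat" where "strict_mono m" "\<And>i. 1 \<le> m i" "\<And>i. i \<le> k i"
    "\<And>i. (\<lambda>x. 1 / sqrt (m i) * \<phi> (k i) x) \<in> V"
proof -
  obtain \<theta> where \<theta>: "L2_expansion \<phi> \<theta> f"
    using basis f(1) by (auto simp: L2_orthonormal_basis_def)
  obtain k where k: "\<And>i. i \<le> k i" "\<And>i. \<theta> (k i) \<noteq> 0"
    using frequently_nonzero_coeff[OF basis \<theta> f(2)] by metis
  obtain m where m: "strict_mono m" "\<And>i. 1 \<le> m i" "\<And>i. nat \<lceil>1 / (\<theta> (k i))\<^sup>2\<rceil> \<le> m i"
    using strict_mono_above[of "\<lambda>i. nat \<lceil>1 / (\<theta> (k i))\<^sup>2\<rceil>"] by blast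
  have "(\<lambda>x. 1 / sqrt (m i) * \<phi> (k i) x) \<in> V" for i
  proof (rule ortho_symmetric_convex_contains_axis[OF basis V \<theta>])
    have "1 / (\<theta> (k i))\<^sup>2 \<le> m i" using m(3)[of i] by linarith
    then have "1 / m i \<le> (\<theta> (k i))\<^sup>2"
      using k(2)[of i] m(2)[of i] by (simp add: field_simps)
    then have "sqrt (1 / m i) \<le> sqrt ((\<theta> (k i))\<^sup>2)" by (rule real_sqrt_le_mono)
    then show "\<bar>1 / sqrt (m i)\<bar> \<le> \<bar>\<theta> (k i)\<bar>" by (simp add: real_sqrt_divide)
  qed
  with m(1,2) k(1) show thesis by (rule that)
qed

theorem theorem8p1:
  fixes M :: "'w measure" and \<xi> :: "nat \<Rightarrow> 'w \<Rightarrow> real"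
    and \<phi> :: "nat \<Rightarrow> real \<Rightarrow> real" and \<kappa> \<sigma> :: "nat \<Rightarrow> real" and r :: real
  assumes noise: "standard_gaussian_noise M \<xi>"
    and basis: "L2_orthonormal_basis \<phi>"
    and D1: "D1 \<kappa>"
    and D2: "D2 \<sigma>"
    and r: "r = 1/2"
  shows
    "(\<forall>l\<ge>1. \<forall>P0>0. \<forall>\<gamma>>0. \<forall>c C. \<forall>m F.
        0 < c \<longrightarrow> c < C \<longrightarrow> strict_mono m \<longrightarrow> (\<forall>i. m i \<ge> 1) \<longrightarrow>
        (\<forall>i. F i \<in> (\<lambda>g x. \<gamma> * g x) ` U_set \<phi> l P0) \<longrightarrow>
        norm_rate_between r c C m F \<longrightarrow>
        consistent_along M \<xi> \<sigma> \<phi> (T_stat \<kappa>) m F)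
     \<and>
     (\<forall>f V. f \<in> L2 \<longrightarrow> f \<notin> Xi_set \<phi> \<longrightarrow>
        V \<subseteq> L2 \<longrightarrow> L2_convex V \<longrightarrow> ortho_symmetric \<phi> V \<longrightarrow> f \<in> V \<longrightarrow>
        (\<exists>c C m F. 0 < c \<and> c < C \<and> strict_mono m \<and> (\<forall>i. m i \<ge> 1) \<and>
           (\<forall>i. F i \<in> V) \<and> norm_rate_between r c C m F \<and>
           inconsistent_along M \<xi> \<sigma> \<phi> (T_stat \<kappa>) m F))"
proof -
  interpret gaussian_sequence_model M \<xi> \<kappa> \<sigma>
    using noise D1 D2 by (rule gaussian_sequence_model.intro)
  show ?thesis
  proof (intro conjI allI impI)
    fix l :: nat and P0 \<gamma> c C :: real and m :: "nat \<Rightarrow> nat" and F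
    assume "1 \<le> l" "0 < c" "\<forall>i. m i \<ge> 1" "\<forall>i. F i \<in> (\<lambda>g x. \<gamma> * g x) ` U_set \<phi> l P0"
      "norm_rate_between r c C m F"
    then show "consistent_along M \<xi> \<sigma> \<phi> (T_stat \<kappa>) m F"
      by (intro consistent_finite_dimensional[OF basis]) (auto simp: r)
  next
    fix f V assume "f \<in> L2" "f \<notin> Xi_set \<phi>" "L2_convex V" "ortho_symmetric \<phi> V" "f \<in> V"
    with basis obtain m k :: "nat \<Rightarrow> nat" where m: "strict_mono m" "\<And>i. 1 \<le> m i"
      and k: "\<And>i. i \<le> k i" and V: "\<And>i. (\<lambda>x. 1 / sqrt (m i) * \<phi> (k i) x) \<in> V"
      by (rule inconsistent_subsequence_exists) (rule that)
    define F where "F i = (\<lambda>x. 1 / sqrt (m i) * \<phi> (k i) x)" for i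
    have "L2_norm (F i) = real (m i) powr (- r)" for i
      unfolding F_def coeffs_of_scaled_basis(2)[OF basis]
      by (simp add: r powr_minus_divide powr_half_sqrt)
    moreover have "0 < real (m i) powr (- r)" for i using m(2)[of i] by simp
    ultimately have "norm_rate_between r (1/2) 2 m F"
      by (simp add: norm_rate_between_def)
    moreover have "inconsistent_along M \<xi> \<sigma> \<phi> (T_stat \<kappa>) m F"
      using m(2) k by (rule inconsistent_axes[OF basis]) (simp add: F_def)
    ultimately show "\<exists>c C m F. 0 < c \<and> c < C \<and> strict_mono m \<and> (\<forall>i. m i \<ge> 1) \<and>
           (\<forall>i. F i \<in> V) \<and> norm_rate_between r c C m F \<and>
           inconsistent_along M \<xi> \<sigma> \<phi> (T_stat \<kappa>) m F"
      using m V by (intro exI[of _ "1/2"] exI[of _ 2] exI[of _ m] exI[of _ F]) (simp add: F_def)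
  qed
qed

end
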